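(* Let $A$ be a countable subset of $\mathbb{R}^+$ with $0 \in A$. (1) If $0$ is not a limit point of $A$ or $0$ is the unique limit point of $A$, then $\mathcal{V}^\star_A$ is Borel. (2) If $0$ is a limit point of $A$ and $A$ is closed and has limit points other than $0$, then $\mathcal{V}^\star_A$ is $\boldsymbol{\Sigma}^1_1$-complete. (3) If $0$ is a limit point of $A$, $A$ is not closed, and no limit point of $A$ different from $0$ belongs to $A$, then $\mathcal{V}^\star_A$ is $\boldsymbol{\Pi}^1_1$-complete. (4) If $0$ is a limit point of $A$, $A$ is not closed, and $A$ contains a limit point of $A$ different from $0$, then $\mathcal{V}^\star_A$ is $D_2(\boldsymbol{\Sigma}^1_1)$-complete.
   Context: $\mathbb{R}^+ = [0,\infty)$. For a metric space $X$ let $D(X) = \{ d_X(x,y) \mid x,y \in X\}$. $\mathbb{U}$ is the Urysohn space and $F(\mathbb{U})$ is the set of nonempty closed subsets of $\mathbb{U}$ with the Effros Borel structure (a standard Borel space). $\mathcal{V}^\star_A = \{X \in F(\mathbb{U}) \mid D(X) = A\}$, considered as a subset of $F(\mathbb{U})$. $D_2(\boldsymbol{\Sigma}^1_1)$ is the class of intersections of an analytic and a coanalytic set. For a class $\Gamma$, a subset $P$ of a standard Borel space $Y$ is $\Gamma$-complete if $P \in \Gamma(Y)$ and for every standard Borel space $X$ and every $B \in \Gamma(X)$ there is a Borel $f \colon X \to Y$ with $f^{-1}(P) = B$. *)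

theory Defs
  imports "HOL-Analysis.Analysis"
begin

definition polish_metric :: "'a set \<Rightarrow> ('a \<Rightarrow> 'a \<Rightarrow> real) \<Rightarrow> bool" where
  "polish_metric M d \<longleftrightarrow>
     Metric_space M d \<and> Metric_space.mcomplete M d \<and>
     separable_space (Metric_space.mtopology M d)"

definition isometric_embedding ::
  "'a set \<Rightarrow> ('a \<Rightarrow> 'a \<Rightarrow> real) \<Rightarrow> 'b set \<Rightarrow> ('b \<Rightarrow> 'b \<Rightarrow> real) \<Rightarrow> ('a \<Rightarrow> 'b) \<Rightarrow> bool" where
  "isometric_embedding M d N e f \<longleftrightarrow>
     f \<in> M \<rightarrow> N \<and> (\<forall>x\<in>M. \<forall>y\<in>M. e (f x) (f y) = d x y)"

text \<open>
  The Urysohn space is, up to isometry, the only Polish metric space that is universal for Polish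
  metric spaces and ultrahomogeneous.  A Polish metric space has at most the cardinality of the
  continuum, so restricting universality to spaces carried by sets of reals loses no isometry type.
\<close>

definition urysohn_space :: "'a set \<Rightarrow> ('a \<Rightarrow> 'a \<Rightarrow> real) \<Rightarrow> bool" where
  "urysohn_space M d \<longleftrightarrow>
     polish_metric M d \<and>
     (\<forall>(N :: real set) e. polish_metric N e \<longrightarrow> (\<exists>f. isometric_embedding N e M d f)) \<and>
     (\<forall>S f. finite S \<and> S \<subseteq> M \<and> isometric_embedding S d M d f \<longrightarrow>
        (\<exists>g. isometric_embedding M d M d g \<and> g ` M = M \<and> (\<forall>x\<in>S. g x = f x)))"


text \<open>A measurable space is represented by the type of measures; the measure itself is ignored.\<close>

definition standard_borel :: "'a measure \<Rightarrow> bool" where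
  "standard_borel X \<longleftrightarrow>
     (\<exists>T. completely_metrizable_space T \<and> second_countable T \<and> topspace T = space X \<and>
        sets X = sigma_sets (topspace T) {U. openin T U})"

text \<open>Projections of Borel subsets of the product with the Baire space \<open>nat \<Rightarrow> nat\<close>.\<close>

definition analytic_sets :: "'a measure \<Rightarrow> 'a set set" where
  "analytic_sets X =
     {fst ` B | B. B \<in> sets (X \<Otimes>\<^sub>M (borel :: (nat \<Rightarrow> nat) measure))}"

definition coanalytic_sets :: "'a measure \<Rightarrow> 'a set set" where
  "coanalytic_sets X = {P. P \<subseteq> space X \<and> space X - P \<in> analytic_sets X}"

text \<open>
  A name for each class, since a class has to be evaluated at spaces over different types.
\<close>

datatype pointclass = Sigma11 | Pi11 | D2_Sigma11

fun in_class :: "pointclass \<Rightarrow> 'a measure \<Rightarrow> 'a set set" where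
  "in_class Sigma11 X = analytic_sets X"
| "in_class Pi11 X = coanalytic_sets X"
| "in_class D2_Sigma11 X = {P \<inter> Q | P Q. P \<in> analytic_sets X \<and> Q \<in> coanalytic_sets X}"

text \<open>
  Completeness quantifies over all standard Borel spaces.  HOL cannot quantify over their carrier
  types inside a formula, so the type is a parameter: completeness of \<open>P\<close> is the
  statement for an arbitrary type variable \<open>'x\<close>.
\<close>

definition pointclass_complete ::
  "'x itself \<Rightarrow> pointclass \<Rightarrow> 'y measure \<Rightarrow> 'y set \<Rightarrow> bool" where
  "pointclass_complete (_ :: 'x itself) \<Gamma> Y P \<longleftrightarrow>
     P \<in> in_class \<Gamma> Y \<and>
     (\<forall>(X :: 'x measure) B. standard_borel X \<and> B \<in> in_class \<Gamma> X \<longrightarrow>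
        (\<exists>f. f \<in> X \<rightarrow>\<^sub>M Y \<and> f -` P \<inter> space X = B))"


definition closed_sets :: "'a topology \<Rightarrow> 'a set set" where
  "closed_sets T = {C. closedin T C \<and> C \<noteq> {}}"

definition effros_borel :: "'a topology \<Rightarrow> 'a set measure" where
  "effros_borel T =
     sigma (closed_sets T) {{C \<in> closed_sets T. C \<inter> U \<noteq> {}} | U. openin T U}"

definition distance_set :: "('a \<Rightarrow> 'a \<Rightarrow> real) \<Rightarrow> 'a set \<Rightarrow> real set" where
  "distance_set d X = {d x y | x y. x \<in> X \<and> y \<in> X}"

definition V_star :: "'a set \<Rightarrow> ('a \<Rightarrow> 'a \<Rightarrow> real) \<Rightarrow> real set \<Rightarrow> 'a set set" where
  "V_star M d A = {X \<in> closed_sets (Metric_space.mtopology M d). distance_set d X = A}"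

end

theory Submission
  imports Defs
begin

text \<open>
  Upper bounds: \<open>A \<subseteq> D(X)\<close> is an analytic and \<open>D(X) \<subseteq> A\<close> a coanalytic condition on \<open>X\<close>.  The
  second is Borel when \<open>A\<close> is closed, and given the second the first is Borel when all nonzero points
  of \<open>A\<close> are isolated in \<open>A\<close>.

  Hardness: an analytic set is represented by a Souslin scheme, that is, by a measurable family of
  trees \<open>T\<^sub>x\<close> that are ill-founded exactly for the points \<open>x\<close> of the set.  Given a limit point
  \<open>r > 0\<close> of \<open>A\<close>, take two copies of \<open>T\<^sub>x\<close>, each with the ultrametric \<open>\<epsilon>\<^sub>n\<close> where \<open>n\<close> is the length of
  the longest common prefix, and put points of different copies at distance \<open>\<rho>\<^sub>n\<close>, where
  \<open>\<epsilon>\<^sub>n, \<rho>\<^sub>n \<in> A\<close>, \<open>\<epsilon>\<^sub>n \<rightarrow> 0\<close>, \<open>\<rho>\<^sub>n \<rightarrow> r\<close> and \<open>\<rho>\<^sub>n \<noteq> r\<close>.  The completion adds the branches of \<open>T\<^sub>x\<close>, so it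
  realises the distance \<open>r\<close> if and only if \<open>T\<^sub>x\<close> is ill-founded.  Further pieces, placed far from one
  another, realise the other elements of \<open>A\<close>, and a second tree controls a second limit point.
  All these spaces are closures in the Urysohn space of subsets of one countable set.
\<close>

section \<open>Analytic sets and Souslin schemes\<close>

text \<open>A basic open set of the product topology restricts only finitely many coordinates;
  \<open>n\<close> bounds them all.\<close>

lemma open_baire_cylinder:
  fixes y :: "nat \<Rightarrow> nat"
  assumes "open U" "y \<in> U"
  obtains n where "{z. map z [0..<n] = map y [0..<n]} \<subseteq> U"
proof -
  have "openin (product_topology (\<lambda>i::nat. euclidean :: nat topology) UNIV) U"
    using assms(1) by (simp add: open_fun_def)
  from product_topology_open_contains_basis[OF this assms(2)] obtain X where
    X: "y \<in> PiE UNIV X" "finite {i. X i \<noteq> UNIV}" "PiE UNIV X \<subseteq> U"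
    by auto
  from X(2) obtain n where n: "{i. X i \<noteq> UNIV} \<subseteq> {..<n}"
    by (metis finite_nat_iff_bounded)
  have "z \<in> PiE UNIV X" if z: "map z [0..<n] = map y [0..<n]" for z
  proof -
    have "z i \<in> X i" for i
    proof (cases "i < n")
      case True
      then have "z i = y i" using z by auto
      then show ?thesis using X(1) by (simp add: PiE_iff)
    next
      case False
      then show ?thesis using n by auto
    qed
    then show ?thesis by (auto simp: PiE_iff)
  qed
  then show ?thesis using X(3) that[of n] by blast
qed

text \<open>A Souslin operation on relations: \<open>x\<close> is tested against measurable sets
  indexed by finite prefixes of the parameter \<open>y\<close> and of a witness \<open>z\<close>.
  Keeping \<open>y\<close> visible lets the class contain the Borel conditions on \<open>y\<close>;
  pairing \<open>y\<close> with \<open>z\<close> later performs the projection.\<close>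

definition souslin :: "'x measure \<Rightarrow> ('x \<Rightarrow> (nat \<Rightarrow> nat) \<Rightarrow> bool) \<Rightarrow> bool" where
  "souslin X R \<longleftrightarrow> (\<exists>P :: nat list \<Rightarrow> nat list \<Rightarrow> 'x set. (\<forall>s t. P s t \<in> sets X) \<and>
     (\<forall>x\<in>space X. \<forall>y. R x y \<longleftrightarrow> (\<exists>z. \<forall>n. x \<in> P (map y [0..<n]) (map z [0..<n]))))"

lemma souslin_cong:
  assumes "\<And>x y. x \<in> space X \<Longrightarrow> R x y = R' x y"
  shows "souslin X R = souslin X R'"
  unfolding souslin_def using assms by (intro ex_cong) auto

lemma souslin_fst:
  assumes "E \<in> sets X"
  shows "souslin X (\<lambda>x y. x \<in> E)"
  unfolding souslin_def by (rule exI[of _ "\<lambda>s t. E"]) (use assms in auto)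

text \<open>The first entry of the witness guesses the length of a prefix of \<open>y\<close> whose
  cylinder lies in \<open>U\<close>.\<close>

lemma souslin_open:
  assumes "open U"
  shows "souslin X (\<lambda>x y. y \<in> U)"
proof -
  \<comment> \<open>The test is vacuous until the prefix \<open>s\<close> has reached the guessed
    length \<open>hd t\<close>.\<close>
  define ok where "ok s t \<longleftrightarrow> t = [] \<or> length s < hd t \<or>
      {z. map z [0..<hd t] = take (hd t) s} \<subseteq> U" for s t :: "nat list"
  define P where "P s t = (if ok s t then space X else {})" for s t
  have "y \<in> U \<longleftrightarrow> (\<exists>z. \<forall>n. x \<in> P (map y [0..<n]) (map z [0..<n]))" if "x \<in> space X" for x y
  proof
    assume "y \<in> U"
    then obtain k where k: "{z. map z [0..<k] = map y [0..<k]} \<subseteq> U"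
      using open_baire_cylinder[OF assms] by metis
    have "ok (map y [0..<n]) (map (\<lambda>_. k) [0..<n])" for n
      using k by (cases "n = 0") (auto simp: ok_def hd_map take_map min_def)
    then show "\<exists>z. \<forall>n. x \<in> P (map y [0..<n]) (map z [0..<n])"
      using that by (intro exI[of _ "\<lambda>_. k"]) (auto simp: P_def)
  next
    assume "\<exists>z. \<forall>n. x \<in> P (map y [0..<n]) (map z [0..<n])"
    then obtain z where z: "\<And>n. ok (map y [0..<n]) (map z [0..<n])"
      unfolding P_def by (metis empty_iff)
    have "{w. map w [0..<z 0] = map y [0..<z 0]} \<subseteq> U"
      using z[of "Suc (z 0)"] by (auto simp: ok_def hd_map take_map min_def simp del: upt_Suc)
    then show "y \<in> U" by auto
  qed
  then show ?thesis
    unfolding souslin_def by (intro exI[of _ P]) (auto simp: P_def)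
qed

text \<open>A point lies outside an open set exactly when none of its prefixes has its cylinder
  inside that set, so the prefixes of \<open>y\<close> alone decide.\<close>

lemma souslin_closed:
  assumes "open U"
  shows "souslin X (\<lambda>x y. y \<notin> U)"
proof -
  define P where
    "P s (t :: nat list) = (if {z. map z [0..<length s] = s} \<subseteq> U then {} else space X)" for s t
  have "y \<notin> U \<longleftrightarrow> (\<exists>z. \<forall>n. x \<in> P (map y [0..<n]) (map z [0..<n]))" if "x \<in> space X" for x y
  proof
    assume "y \<notin> U"
    then show "\<exists>z. \<forall>n. x \<in> P (map y [0..<n]) (map z [0..<n])"
      using that by (auto simp: P_def)
  next
    assume "\<exists>z. \<forall>n. x \<in> P (map y [0..<n]) (map z [0..<n])"
    then have *: "\<not> {z. map z [0..<n] = map y [0..<n]} \<subseteq> U" for n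
      unfolding P_def by (metis empty_iff length_map length_upt diff_zero)
    then show "y \<notin> U"
      using open_baire_cylinder[OF assms] by metis
  qed
  then show ?thesis
    unfolding souslin_def by (intro exI[of _ P]) (auto simp: P_def)
qed

lemma souslin_familyE:
  fixes X :: "'x measure"
  assumes "\<And>k::nat. souslin X (R k)"
  obtains P :: "nat \<Rightarrow> nat list \<Rightarrow> nat list \<Rightarrow> 'x set"
    where "\<And>k s t. P k s t \<in> sets X"
    "\<And>k x y. x \<in> space X \<Longrightarrow>
      R k x y \<longleftrightarrow> (\<exists>z. \<forall>n. x \<in> P k (map y [0..<n]) (map z [0..<n]))"
proof -
  have "\<forall>k. \<exists>P :: nat list \<Rightarrow> nat list \<Rightarrow> 'x set. (\<forall>s t. P s t \<in> sets X) \<and>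
     (\<forall>x\<in>space X. \<forall>y. R k x y \<longleftrightarrow> (\<exists>z. \<forall>n. x \<in> P (map y [0..<n]) (map z [0..<n])))"
    using assms unfolding souslin_def by blast
  from choice[OF this] show ?thesis using that by blast
qed

text \<open>The first entry of the new witness names \<open>k\<close>; the remaining entries form a
  witness for \<open>R k\<close>.\<close>

lemma souslin_countable_Ex:
  fixes X :: "'x measure"
  assumes "\<And>k::nat. souslin X (R k)"
  shows "souslin X (\<lambda>x y. \<exists>k. R k x y)"
proof -
  obtain P :: "nat \<Rightarrow> nat list \<Rightarrow> nat list \<Rightarrow> 'x set"
    where P: "\<And>k s t. P k s t \<in> sets X" and
    PR: "\<And>k x y. x \<in> space X \<Longrightarrow>
      R k x y \<longleftrightarrow> (\<exists>z. \<forall>n. x \<in> P k (map y [0..<n]) (map z [0..<n]))"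
    by (rule souslin_familyE[of X R], rule assms, rule that)
  \<comment> \<open>Removing the first entry of \<open>t\<close> shortens it by one, so the last
    entry of \<open>s\<close> is dropped as well to keep both prefixes equally long.\<close>
  define Q where "Q s t = (if t = [] then space X else P (hd t) (butlast s) (tl t))"
    for s t :: "nat list"
  have Q0: "Q (map y [0..<0]) (map z [0..<0]) = space X" for y z
    by (simp add: Q_def)
  have QS: "Q (map y [0..<Suc n]) (map z [0..<Suc n]) =
      P (z 0) (map y [0..<n]) (map (\<lambda>i. z (Suc i)) [0..<n])" for y z n
  proof -
    have *: "[0..<Suc n] = 0 # map Suc [0..<n]"
      by (simp add: map_Suc_upt upt_conv_Cons del: upt_Suc)
    have "map z [0..<Suc n] = z 0 # map (\<lambda>i. z (Suc i)) [0..<n]"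
      unfolding * by (simp add: comp_def)
    then show ?thesis by (simp add: Q_def)
  qed
  have "(\<exists>k. R k x y) \<longleftrightarrow> (\<exists>z. \<forall>n. x \<in> Q (map y [0..<n]) (map z [0..<n]))"
    if x: "x \<in> space X" for x y
  proof
    assume "\<exists>k. R k x y"
    then obtain k z where z: "\<And>n. x \<in> P k (map y [0..<n]) (map z [0..<n])"
      using PR[OF x] by blast
    have "x \<in> Q (map y [0..<n]) (map (case_nat k z) [0..<n])" for n
    proof (cases n)
      case 0
      then show ?thesis using x Q0 by metis
    next
      case (Suc m)
      then show ?thesis using z[of m] unfolding Suc QS by simp
    qed
    then show "\<exists>z. \<forall>n. x \<in> Q (map y [0..<n]) (map z [0..<n])" by blast
  next
    assume "\<exists>z. \<forall>n. x \<in> Q (map y [0..<n]) (map z [0..<n])"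
    then obtain z where "\<And>n. x \<in> Q (map y [0..<n]) (map z [0..<n])" by blast
    then have "x \<in> P (z 0) (map y [0..<n]) (map (\<lambda>i. z (Suc i)) [0..<n])" for n
      using QS by metis
    then show "\<exists>k. R k x y" using PR[OF x] by blast
  qed
  then show ?thesis
    unfolding souslin_def by (intro exI[of _ Q]) (use P in \<open>auto simp: Q_def\<close>)
qed

text \<open>One sequence codes a witness for every \<open>k\<close>: entry \<open>m\<close> of the
  \<open>k\<close>-th witness sits at position \<open>prod_encode (k, m)\<close>.\<close>

lemma souslin_countable_All:
  fixes X :: "'x measure"
  assumes "\<And>k::nat. souslin X (R k)"
  shows "souslin X (\<lambda>x y. \<forall>k. R k x y)"
proof -
  obtain P :: "nat \<Rightarrow> nat list \<Rightarrow> nat list \<Rightarrow> 'x set"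
    where P: "\<And>k s t. P k s t \<in> sets X" and
    PR: "\<And>k x y. x \<in> space X \<Longrightarrow>
      R k x y \<longleftrightarrow> (\<exists>z. \<forall>n. x \<in> P k (map y [0..<n]) (map z [0..<n]))"
    by (rule souslin_familyE[of X R], rule assms, rule that)
  \<comment> \<open>\<open>ok\<close> says that the first \<open>n\<close> entries of
    \<open>y\<close> and of the \<open>k\<close>-th witness can already be read from
    \<open>s\<close> and \<open>t\<close>. Until then the test is postponed by answering
    \<open>space X\<close>.\<close>
  define ok where "ok s t k n \<longleftrightarrow> n \<le> length s \<and> (\<forall>m<n. prod_encode (k, m) < length t)"
    for s t :: "nat list" and k n
  define S where "S s t k n = (if ok s t k n
      then P k (take n s) (map (\<lambda>m. t ! prod_encode (k, m)) [0..<n]) else space X)" for s t k n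
  define Q where "Q s t = {x\<in>space X. \<forall>k n. x \<in> S s t k n}" for s t
  have S: "S s t k n \<in> sets X" for s t k n
    using P by (simp add: S_def)
  have Q: "Q s t \<in> sets X" for s t
    unfolding Q_def using S by measurable
  have SP: "S (map y [0..<N]) (map z [0..<N]) k n =
      P k (map y [0..<n]) (map (\<lambda>m. z (prod_encode (k, m))) [0..<n])"
    if "ok (map y [0..<N]) (map z [0..<N]) k n" for y z k n N
  proof -
    have "map z [0..<N] ! prod_encode (k, m) = z (prod_encode (k, m))" if "m < n" for m
      using \<open>ok _ _ k n\<close> that by (simp add: ok_def)
    then have *: "map (\<lambda>m. map z [0..<N] ! prod_encode (k, m)) [0..<n] =
        map (\<lambda>m. z (prod_encode (k, m))) [0..<n]"
      by simp
    have "S (map y [0..<N]) (map z [0..<N]) k n = P k (take n (map y [0..<N]))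
        (map (\<lambda>m. map z [0..<N] ! prod_encode (k, m)) [0..<n])"
      using that by (simp only: S_def if_True)
    also have "take n (map y [0..<N]) = map y [0..<n]"
      using that by (simp add: ok_def take_map min_def)
    finally show ?thesis unfolding * .
  qed
  have "(\<forall>k. R k x y) \<longleftrightarrow> (\<exists>z. \<forall>n. x \<in> Q (map y [0..<n]) (map z [0..<n]))"
    if x: "x \<in> space X" for x y
  proof
    assume "\<forall>k. R k x y"
    then have "\<forall>k. \<exists>z. \<forall>n. x \<in> P k (map y [0..<n]) (map z [0..<n])"
      using PR[OF x] by blast
    from choice[OF this] obtain z where z: "\<And>k n. x \<in> P k (map y [0..<n]) (map (z k) [0..<n])"
      by blast
    define w where "w i = case_prod z (prod_decode i)" for i
    have "x \<in> S (map y [0..<N]) (map w [0..<N]) k n" for N k n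
    proof (cases "ok (map y [0..<N]) (map w [0..<N]) k n")
      case True
      then show ?thesis using z[of k n] by (simp add: SP w_def)
    qed (use x in \<open>simp add: S_def\<close>)
    then show "\<exists>z. \<forall>n. x \<in> Q (map y [0..<n]) (map z [0..<n])"
      using x by (auto simp: Q_def)
  next
    assume "\<exists>z. \<forall>n. x \<in> Q (map y [0..<n]) (map z [0..<n])"
    then obtain z where z: "\<And>N k n. x \<in> S (map y [0..<N]) (map z [0..<N]) k n"
      unfolding Q_def by blast
    have "x \<in> P k (map y [0..<n]) (map (\<lambda>m. z (prod_encode (k, m))) [0..<n])" for k n
    proof -
      \<comment> \<open>A prefix long enough to contain the first \<open>n\<close> positions of row
        \<open>k\<close>; their sum bounds each of them.\<close>
      define N where "N = n + Suc (\<Sum>m<n. prod_encode (k, m))"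
      have "prod_encode (k, m) < N" if "m < n" for m
        using member_le_sum[of m "{..<n}" "\<lambda>m. prod_encode (k, m)"] that by (simp add: N_def)
      then have "ok (map y [0..<N]) (map z [0..<N]) k n"
        by (simp add: ok_def N_def)
      then show ?thesis using z[of N k n] by (simp add: SP)
    qed
    then show "\<forall>k. R k x y" using PR[OF x] by blast
  qed
  then show ?thesis
    unfolding souslin_def by (intro exI[of _ Q]) (use Q in auto)
qed

text \<open>Souslin relations are closed under countable unions and intersections but not in general
  under complements. The induction therefore carries a relation together with its negation, and the
  complement step swaps the two.\<close>

lemma sigma_sets_imp_souslin:
  assumes "a \<in> sigma_sets \<Omega> G"
    and "\<And>g. g \<in> G \<Longrightarrow> souslin X (\<lambda>x y. h x y \<in> g) \<and> souslin X (\<lambda>x y. h x y \<notin> g)"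
    and "\<And>x y. x \<in> space X \<Longrightarrow> h x y \<in> \<Omega>"
  shows "souslin X (\<lambda>x y. h x y \<in> a) \<and> souslin X (\<lambda>x y. h x y \<notin> a)"
  using assms(1)
proof induction
  case (Basic a)
  then show ?case by (rule assms(2))
next
  case Empty
  then show ?case using souslin_fst[of "space X" X] souslin_fst[of "{}" X]
    by (auto cong: souslin_cong)
next
  case (Compl a)
  have "souslin X (\<lambda>x y. h x y \<in> \<Omega> - a) = souslin X (\<lambda>x y. h x y \<notin> a)"
       "souslin X (\<lambda>x y. h x y \<notin> \<Omega> - a) = souslin X (\<lambda>x y. h x y \<in> a)"
    using assms(3) by (auto intro!: souslin_cong)
  then show ?case using Compl.IH by simp
next
  case (Union a)
  then show ?case
    using souslin_countable_Ex[of X "\<lambda>k x y. h x y \<in> a k"]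
      souslin_countable_All[of X "\<lambda>k x y. h x y \<notin> a k"] by simp
qed

lemma measurable_imp_souslin:
  assumes "C \<in> sets (X \<Otimes>\<^sub>M (borel :: (nat \<Rightarrow> nat) measure))"
  shows "souslin X (\<lambda>x y. (x, y) \<in> C)"
proof -
  have b: "souslin X (\<lambda>x y. y \<in> b) \<and> souslin X (\<lambda>x y. y \<notin> b)"
    if "b \<in> sets (borel :: (nat \<Rightarrow> nat) measure)" for b
    using that sigma_sets_imp_souslin[of b UNIV "{U. open U}" X "\<lambda>x y. y"]
      souslin_open souslin_closed by (auto simp: borel_def)
  have gen: "souslin X (\<lambda>x y. (x, y) \<in> g) \<and> souslin X (\<lambda>x y. (x, y) \<notin> g)"
    if g: "g \<in> {a \<times> b |a b. a \<in> sets X \<and> b \<in> sets (borel :: (nat \<Rightarrow> nat) measure)}" for g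
  proof -
    obtain a b where ab: "g = a \<times> b" "a \<in> sets X" "b \<in> sets (borel :: (nat \<Rightarrow> nat) measure)"
      using g by blast
    \<comment> \<open>A rectangle is a conjunction and its complement a disjunction; both are padded
      to countable quantifiers.\<close>
    have "souslin X (\<lambda>x y. \<forall>k::nat. if k = 0 then x \<in> a else y \<in> b)"
      by (rule souslin_countable_All, case_tac "k = 0")
        (use b[OF ab(3)] souslin_fst[OF ab(2)] in auto)
    moreover have "souslin X (\<lambda>x y. \<exists>k::nat. if k = 0 then x \<in> space X - a else y \<notin> b)"
      by (rule souslin_countable_Ex, case_tac "k = 0")
        (use b[OF ab(3)] souslin_fst[of "space X - a" X] ab(2) in auto)
    moreover have "(\<forall>k::nat. if k = 0 then A else B) = (A \<and> B)"
      "(\<exists>k::nat. if k = 0 then A else B) = (A \<or> B)" for A B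
      by (metis zero_neq_one)+
    ultimately show ?thesis
      unfolding ab(1) by (auto cong: souslin_cong)
  qed
  have "C \<in> sigma_sets (space X \<times> UNIV)
      {a \<times> b |a b. a \<in> sets X \<and> b \<in> sets (borel :: (nat \<Rightarrow> nat) measure)}"
    using assms by (simp add: sets_pair_measure)
  from sigma_sets_imp_souslin[where h = Pair, OF this gen] show ?thesis by auto
qed

text \<open>Projecting away \<open>y\<close> leaves \<open>y\<close> and the witness
  \<open>z\<close> both existentially quantified. Pairing them entrywise into one sequence
  \<open>w\<close> exhibits the set as the result of a Souslin operation.\<close>

lemma analytic_sets_scheme:
  fixes X :: "'x measure"
  assumes "B \<in> analytic_sets X"
  obtains Q :: "nat list \<Rightarrow> 'x set" where "\<And>u. Q u \<in> sets X" and
    "\<And>x. x \<in> space X \<Longrightarrow> x \<in> B \<longleftrightarrow> (\<exists>w. \<forall>n. x \<in> Q (map w [0..<n]))"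
proof -
  obtain C where C: "B = fst ` C" "C \<in> sets (X \<Otimes>\<^sub>M (borel :: (nat \<Rightarrow> nat) measure))"
    using assms unfolding analytic_sets_def by blast
  obtain P :: "nat list \<Rightarrow> nat list \<Rightarrow> 'x set" where P: "\<And>s t. P s t \<in> sets X" and
    PC: "\<And>x y. x \<in> space X \<Longrightarrow>
      (x, y) \<in> C \<longleftrightarrow> (\<exists>z. \<forall>n. x \<in> P (map y [0..<n]) (map z [0..<n]))"
    using measurable_imp_souslin[OF C(2)] unfolding souslin_def by metis
  define Q where "Q u = P (map (fst \<circ> prod_decode) u) (map (snd \<circ> prod_decode) u)" for u
  have "x \<in> B \<longleftrightarrow> (\<exists>w. \<forall>n. x \<in> Q (map w [0..<n]))" if x: "x \<in> space X" for x
  proof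
    assume "x \<in> B"
    then obtain y z where yz: "\<And>n. x \<in> P (map y [0..<n]) (map z [0..<n])"
      using PC[OF x] C(1) by force
    show "\<exists>w. \<forall>n. x \<in> Q (map w [0..<n])"
      by (rule exI[of _ "\<lambda>i. prod_encode (y i, z i)"]) (use yz in \<open>simp add: Q_def comp_def\<close>)
  next
    assume "\<exists>w. \<forall>n. x \<in> Q (map w [0..<n])"
    then obtain w where w: "\<And>n. x \<in> Q (map w [0..<n])" by blast
    have "(x, fst \<circ> prod_decode \<circ> w) \<in> C"
      unfolding PC[OF x] by (rule exI[of _ "snd \<circ> prod_decode \<circ> w"]) (use w in \<open>simp add: Q_def\<close>)
    then show "x \<in> B" unfolding C(1) by force
  qed
  then show ?thesis using that[of Q] P by (auto simp: Q_def)
qed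

section \<open>Closure properties of analytic sets\<close>

lemma analytic_sets_subset: "B \<in> analytic_sets X \<Longrightarrow> B \<subseteq> space X"
  unfolding analytic_sets_def using sets.sets_into_space by (fastforce simp: space_pair_measure)

lemma analytic_sets_Un:
  assumes "B \<in> analytic_sets X" "B' \<in> analytic_sets X"
  shows "B \<union> B' \<in> analytic_sets X"
proof -
  obtain C C' where "B = fst ` C" "C \<in> sets (X \<Otimes>\<^sub>M (borel :: (nat \<Rightarrow> nat) measure))"
    "B' = fst ` C'" "C' \<in> sets (X \<Otimes>\<^sub>M (borel :: (nat \<Rightarrow> nat) measure))"
    using assms unfolding analytic_sets_def by blast
  then show ?thesis
    unfolding analytic_sets_def by (auto intro!: exI[of _ "C \<union> C'"])
qed

lemma sets_imp_analytic:
  assumes "B \<in> sets X"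
  shows "B \<in> analytic_sets X"
proof -
  have "B \<times> UNIV \<in> sets (X \<Otimes>\<^sub>M (borel :: (nat \<Rightarrow> nat) measure))"
    using assms by (intro pair_measureI) auto
  moreover have "B = fst ` (B \<times> (UNIV :: (nat \<Rightarrow> nat) set))" by auto
  ultimately show ?thesis unfolding analytic_sets_def by blast
qed

lemma continuous_on_component_comp:
  "continuous_on UNIV (\<lambda>(y :: nat \<Rightarrow> 'a::topological_space) n. y (g n))"
  by (intro continuous_on_coordinatewise_then_product) simp

text \<open>A single point of Baire space codes the witnesses for all \<open>k\<close> as its rows;
  \<open>h k\<close> reads off the \<open>k\<close>-th row, and \<open>D\<close> requires all rows
  to be correct at once.\<close>

lemma analytic_sets_INT:
  assumes "\<And>k::nat. B k \<in> analytic_sets X"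
  shows "(\<Inter>k. B k) \<in> analytic_sets X"
proof -
  have "\<forall>k. \<exists>C. B k = fst ` C \<and> C \<in> sets (X \<Otimes>\<^sub>M (borel :: (nat \<Rightarrow> nat) measure))"
    using assms unfolding analytic_sets_def by blast
  then obtain C where C: "\<And>k. B k = fst ` C k"
    "\<And>k. C k \<in> sets (X \<Otimes>\<^sub>M (borel :: (nat \<Rightarrow> nat) measure))"
    by metis
  define h :: "nat \<Rightarrow> 'a \<times> (nat \<Rightarrow> nat) \<Rightarrow> 'a \<times> (nat \<Rightarrow> nat)"
    where "h k = (\<lambda>(x, y). (x, \<lambda>n. y (prod_encode (k, n))))" for k
  have [measurable]: "(\<lambda>y n. y (prod_encode (k, n))) \<in>
      (borel :: (nat \<Rightarrow> nat) measure) \<rightarrow>\<^sub>M (borel :: (nat \<Rightarrow> nat) measure)" for k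
    by (intro borel_measurable_continuous_onI continuous_on_component_comp)
  have h: "h k \<in> X \<Otimes>\<^sub>M borel \<rightarrow>\<^sub>M X \<Otimes>\<^sub>M borel" for k
    unfolding h_def by measurable
  define D where "D = (\<Inter>k. h k -` C k \<inter> space (X \<Otimes>\<^sub>M (borel :: (nat \<Rightarrow> nat) measure)))"
  have "D \<in> sets (X \<Otimes>\<^sub>M borel)"
    unfolding D_def using measurable_sets[OF h C(2)] by (intro sets.countable_INT) auto
  moreover have "(\<Inter>k. B k) = fst ` D"
  proof
    show "(\<Inter>k. B k) \<subseteq> fst ` D"
    proof
      fix x assume x: "x \<in> (\<Inter>k. B k)"
      then have "\<forall>k. \<exists>y. (x, y) \<in> C k" using C(1) by force
      then obtain y where y: "\<And>k. (x, y k) \<in> C k" by metis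
      have "x \<in> space X" using x analytic_sets_subset[OF assms[of 0]] by auto
      then have "(x, \<lambda>i. case_prod y (prod_decode i)) \<in> D"
        using y by (auto simp: D_def h_def space_pair_measure)
      then show "x \<in> fst ` D" by force
    qed
    show "fst ` D \<subseteq> (\<Inter>k. B k)"
      unfolding D_def h_def C(1) by (force simp: image_iff)
  qed
  ultimately show ?thesis unfolding analytic_sets_def by blast
qed

section \<open>Complexity of distance sets in the Effros Borel structure\<close>

lemma space_effros_borel [simp]: "space (effros_borel T) = closed_sets T"
  unfolding effros_borel_def by (rule space_measure_of) auto

lemma effros_borel_hit:
  assumes "openin T U"
  shows "{C \<in> closed_sets T. C \<inter> U \<noteq> {}} \<in> sets (effros_borel T)"
  using assms unfolding effros_borel_def by (subst sets_measure_of) auto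

lemma measurable_effros_borelI:
  assumes "\<And>x. x \<in> space X \<Longrightarrow> f x \<in> closed_sets T"
    and "\<And>U. openin T U \<Longrightarrow> {x \<in> space X. f x \<inter> U \<noteq> {}} \<in> sets X"
  shows "f \<in> X \<rightarrow>\<^sub>M effros_borel T"
  unfolding effros_borel_def
proof (rule measurable_measure_of)
  fix Y assume "Y \<in> {{C \<in> closed_sets T. C \<inter> U \<noteq> {}} |U. openin T U}"
  then obtain U where U: "openin T U" "Y = {C \<in> closed_sets T. C \<inter> U \<noteq> {}}" by blast
  have "f -` Y \<inter> space X = {x \<in> space X. f x \<inter> U \<noteq> {}}"
    using U(2) assms(1) by auto
  then show "f -` Y \<inter> space X \<in> sets X" using assms(2)[OF U(1)] by simp
qed (use assms(1) in auto)

lemma analytic_sets_Int: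
  assumes "B \<in> analytic_sets X" "B' \<in> analytic_sets X"
  shows "B \<inter> B' \<in> analytic_sets X"
proof -
  have "(\<Inter>k::nat. if k = 0 then B else B') \<in> analytic_sets X"
    by (rule analytic_sets_INT) (use assms in auto)
  moreover have "(\<Inter>k::nat. if k = 0 then B else B') = B \<inter> B'"
    by (auto split: if_splits)
  ultimately show ?thesis by simp
qed

lemma coanalytic_sets_Int_sets:
  assumes "P \<in> coanalytic_sets X" "G \<in> sets X"
  shows "P \<inter> G \<in> coanalytic_sets X"
proof -
  have "space X - P \<inter> G = (space X - P) \<union> (space X - G)" by auto
  then show ?thesis
    using assms analytic_sets_Un[of "space X - P" X "space X - G"]
      sets_imp_analytic[of "space X - G" X]
    by (auto simp: coanalytic_sets_def)
qed

lemma countable_sets_borel: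
  fixes A :: "'a::t1_space set"
  assumes "countable A"
  shows "A \<in> sets borel"
proof -
  have "(\<Union>a\<in>A. {a}) \<in> sets borel"
    using assms by (intro sets.countable_UN') auto
  then show ?thesis by simp
qed

lemma (in Metric_space) tendsto_mdist:
  assumes s: "range s \<subseteq> M" "(\<lambda>n. d (s n) x) \<longlonglongrightarrow> 0" and t: "range t \<subseteq> M" "(\<lambda>n. d (t n) y) \<longlonglongrightarrow> 0"
    and xy: "x \<in> M" "y \<in> M"
  shows "(\<lambda>n. d (s n) (t n)) \<longlonglongrightarrow> d x y"
proof -
  have "(\<lambda>n. d (s n) (t n) - d x y) \<longlonglongrightarrow> 0"
  proof (rule Lim_null_comparison)
    show "\<forall>\<^sub>F n in sequentially. norm (d (s n) (t n) - d x y) \<le> d (s n) x + d (t n) y"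
    proof (intro always_eventually allI)
      fix n
      have M: "s n \<in> M" "t n \<in> M" using s t by auto
      show "norm (d (s n) (t n) - d x y) \<le> d (s n) x + d (t n) y"
        using triangle[of "s n" x "t n"] triangle[of x y "t n"] triangle[of x "s n" y]
          triangle[of "s n" "t n" y] M xy commute[of x "s n"] commute[of y "t n"]
        by (simp add: abs_le_iff)
    qed
    show "(\<lambda>n. d (s n) x + d (t n) y) \<longlonglongrightarrow> 0"
      using tendsto_add[OF s(2) t(2)] by simp
  qed
  then show ?thesis by (simp add: LIM_zero_iff)
qed

text \<open>The balls around the points \<open>q n\<close> give a countable base, through which
  conditions on closed sets reduce to countably many hit conditions.\<close>

locale metric_with_dense_sequence = Metric_space M d
  for M :: "'a set" and d +
  fixes q :: "nat \<Rightarrow> 'a"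
  assumes q_in [simp]: "q n \<in> M"
    and q_dense: "x \<in> M \<Longrightarrow> 0 < r \<Longrightarrow> \<exists>n. d (q n) x < r"
begin

abbreviation "CL \<equiv> closed_sets mtopology"
abbreviation "EB \<equiv> effros_borel mtopology"

lemma CL_subset: "C \<in> CL \<Longrightarrow> C \<subseteq> M"
  unfolding closed_sets_def using closedin_subset by fastforce

lemma pred_hit [measurable]: "openin mtopology U \<Longrightarrow> Measurable.pred EB (\<lambda>C. C \<inter> U \<noteq> {})"
  using effros_borel_hit[of mtopology U] by (simp add: pred_def)

definition meets :: "'a set \<Rightarrow> 'a set \<Rightarrow> real set \<Rightarrow> 'a set \<Rightarrow> bool" where
  "meets U V W C \<longleftrightarrow> (\<exists>x\<in>C \<inter> U. \<exists>y\<in>C \<inter> V. d x y \<in> W)"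

text \<open>\<open>U\<close>, \<open>V\<close>, \<open>W\<close> are open and \<open>d\<close> is
  continuous, so a witnessing pair can be thickened to two balls around points \<open>q n\<close>
  and \<open>q m\<close> all of whose pairs are witnesses. This leaves a countable combination of
  generators of the Effros structure.\<close>

lemma pred_meets [measurable]:
  assumes "openin mtopology U" "openin mtopology V" "open W"
  shows "Measurable.pred EB (meets U V W)"
proof -
  define ok where "ok r n m \<longleftrightarrow> mball (q n) r \<subseteq> U \<and> mball (q m) r \<subseteq> V \<and>
    (\<forall>x\<in>mball (q n) r. \<forall>y\<in>mball (q m) r. d x y \<in> W)" for r n m
  define b where "b n k = mball (q n) (inverse (real (Suc k)))" for n k
  have [measurable]: "Measurable.pred EB (\<lambda>C. C \<inter> b n k \<noteq> {})" for n k
    unfolding b_def by (rule pred_hit) auto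
  have "meets U V W C \<longleftrightarrow>
      (\<exists>n m k. ok (inverse (real (Suc k))) n m \<and> C \<inter> b n k \<noteq> {} \<and> C \<inter> b m k \<noteq> {})"
    if C: "C \<in> CL" for C
  proof
    assume "meets U V W C"
    then obtain x y where xy: "x \<in> C" "x \<in> U" "y \<in> C" "y \<in> V" "d x y \<in> W"
      unfolding meets_def by blast
    have M: "x \<in> M" "y \<in> M" using xy CL_subset[OF C] by auto
    obtain r1 r2 where r1: "r1 > 0" "mball x r1 \<subseteq> U" and r2: "r2 > 0" "mball y r2 \<subseteq> V"
      using assms(1,2) xy unfolding openin_mtopology by meson
    obtain r3 where r3: "r3 > 0" "\<And>v. \<bar>v - d x y\<bar> < r3 \<Longrightarrow> v \<in> W"
      using assms(3) xy(5) unfolding open_dist dist_real_def by meson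
    \<comment> \<open>With balls of radius \<open>e < r\<close> around nearby points of the dense
      sequence, every point of a ball is within \<open>2 * e\<close> of \<open>x\<close> or
      \<open>y\<close>. Distances between the two balls thus differ from \<open>d x y\<close> by
      less than \<open>4 * e\<close>.\<close>
    define r where "r = min (r1/2) (min (r2/2) (r3/4))"
    have "r > 0" using r1 r2 r3 by (simp add: r_def)
    then obtain k where k: "inverse (real (Suc k)) < r"
      using reals_Archimedean by blast
    define e where "e = inverse (real (Suc k))"
    have e: "0 < e" "2 * e < r1" "2 * e < r2" "4 * e < r3"
      using k by (auto simp: e_def r_def)
    obtain n where n: "d (q n) x < e" using q_dense[OF M(1) e(1)] by blast
    obtain m where m: "d (q m) y < e" using q_dense[OF M(2) e(1)] by blast
    have x': "d x x' < 2 * e" if "x' \<in> mball (q n) e" for x'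
      using that triangle[of x "q n" x'] n M by (simp add: commute)
    have y': "d y y' < 2 * e" if "y' \<in> mball (q m) e" for y'
      using that triangle[of y "q m" y'] m M by (simp add: commute)
    have "ok e n m"
      unfolding ok_def
    proof (intro conjI ballI subsetI)
      fix x' assume "x' \<in> mball (q n) e"
      then have "x' \<in> mball x r1" using x'[of x'] e M by simp
      then show "x' \<in> U" using r1 by blast
    next
      fix y' assume "y' \<in> mball (q m) e"
      then have "y' \<in> mball y r2" using y'[of y'] e M by simp
      then show "y' \<in> V" using r2 by blast
    next
      fix x' y' assume *: "x' \<in> mball (q n) e" "y' \<in> mball (q m) e"
      then have M': "x' \<in> M" "y' \<in> M" by auto
      have "\<bar>d x' y' - d x y\<bar> < r3"
        using x'[OF *(1)] y'[OF *(2)] e(4) M M'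
          triangle[of x' x y'] triangle[of x y y'] triangle[of x x' y] triangle[of x' y' y]
          commute[of x x'] commute[of y y'] by linarith
      then show "d x' y' \<in> W" by (rule r3(2))
    qed
    moreover have "x \<in> b n k" "y \<in> b m k" using n m M by (auto simp: b_def e_def)
    ultimately show "\<exists>n m k. ok (inverse (real (Suc k))) n m \<and> C \<inter> b n k \<noteq> {} \<and> C \<inter> b m k \<noteq> {}"
      using xy unfolding e_def by blast
  next
    assume "\<exists>n m k. ok (inverse (real (Suc k))) n m \<and> C \<inter> b n k \<noteq> {} \<and> C \<inter> b m k \<noteq> {}"
    then show "meets U V W C"
      unfolding ok_def meets_def b_def by blast
  qed
  then have "Measurable.pred EB (meets U V W) = Measurable.pred EB
    (\<lambda>C. \<exists>n m k. ok (inverse (real (Suc k))) n m \<and> C \<inter> b n k \<noteq> {} \<and> C \<inter> b m k \<noteq> {})"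
    by (intro measurable_cong) simp
  also have "\<dots>" by measurable
  finally show ?thesis .
qed

lemma sets_meets_open:
  assumes "open W"
  shows "{C \<in> CL. distance_set d C \<inter> W \<noteq> {}} \<in> sets EB"
proof -
  have "{C \<in> CL. meets M M W C} \<in> sets EB"
    using pred_meets[of M M W] assms by (simp add: pred_def)
  moreover have "{C \<in> CL. meets M M W C} = {C \<in> CL. distance_set d C \<inter> W \<noteq> {}}"
    using CL_subset unfolding meets_def distance_set_def by fastforce
  ultimately show ?thesis by simp
qed

lemma sets_distance_subset_closed:
  assumes "closed A"
  shows "{C \<in> CL. distance_set d C \<subseteq> A} \<in> sets EB"
proof -
  have "space EB - {C \<in> CL. distance_set d C \<inter> - A \<noteq> {}} \<in> sets EB"
    using assms by (intro sets.compl_sets sets_meets_open) auto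
  moreover have "space EB - {C \<in> CL. distance_set d C \<inter> - A \<noteq> {}} = {C \<in> CL. distance_set d C \<subseteq> A}"
    by auto
  ultimately show ?thesis by simp
qed

text \<open>A point of a closed set is coded by a sequence of indices \<open>n\<^sub>k\<close> such that the balls of radius
  \<open>1 / (k + 1)\<close> around \<open>q n\<^sub>k\<close> all meet the set.\<close>

lemma analytic_meets_borel:
  assumes mcomplete and K [measurable]: "K \<in> sets borel"
  shows "{C \<in> CL. distance_set d C \<inter> K \<noteq> {}} \<in> analytic_sets EB"
proof -
  let ?X = "EB \<Otimes>\<^sub>M (borel :: (nat \<Rightarrow> nat) measure)"
  define e where "e n = inverse (real (Suc n))" for n
  have e_pos: "e n > 0" for n by (simp add: e_def)
  have e_lim: "e \<longlonglongrightarrow> 0" unfolding e_def by (rule LIMSEQ_inverse_real_of_nat)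
  \<comment> \<open>The even entries of a code describe one point, the odd entries the
    other.\<close>
  define a b where "a y n = q (y (2 * n))" and "b y n = q (y (2 * n + 1))"
    for y :: "nat \<Rightarrow> nat" and n
  \<comment> \<open>The first clause makes the decoded sequence Cauchy; the second puts its limit
    into the closed set \<open>C\<close>. Both are Borel conditions on \<open>C\<close> and the
    code.\<close>
  define good where "good C s \<longleftrightarrow> (\<forall>n m. d (s n) (s m) < e n + e m) \<and>
    (\<forall>n. C \<inter> mball (s n) (e n) \<noteq> {})" for C s
  define B where "B = {p \<in> space ?X. good (fst p) (a (snd p)) \<and> good (fst p) (b (snd p)) \<and>
     lim (\<lambda>n. d (a (snd p) n) (b (snd p) n)) \<in> K}"
  have coord [measurable]: "(\<lambda>p. snd p k) \<in> ?X \<rightarrow>\<^sub>M count_space UNIV" for k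
  proof -
    have "(\<lambda>p. snd p k) \<in> borel_measurable ?X"
      by (rule measurable_compose[OF measurable_snd measurable_product_coordinates])
    then show ?thesis
      using measurable_cong_sets[OF refl sets_borel_eq_count_space] by blast
  qed
  have hit [measurable]:
    "Measurable.pred ?X (\<lambda>p. fst p \<inter> mball (q (snd p k)) r \<noteq> {})" for k r
  proof -
    have [measurable]: "Measurable.pred EB (\<lambda>C. C \<inter> mball (q i) r \<noteq> {})" for i
      by (rule pred_hit) auto
    have "Measurable.pred ?X (\<lambda>p. \<exists>i. snd p k = i \<and> fst p \<inter> mball (q i) r \<noteq> {})"
      by measurable
    then show ?thesis by simp
  qed
  have B: "B \<in> sets ?X"
    unfolding B_def good_def a_def b_def by measurable
  have limit: "\<exists>x\<in>C. (\<lambda>n. d (s n) x) \<longlonglongrightarrow> 0" if C: "C \<in> CL" and s: "range s \<subseteq> M" "good C s" for C s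
  proof -
    have "MCauchy s"
      unfolding MCauchy_def
    proof (intro conjI allI impI)
      fix \<epsilon> :: real assume "\<epsilon> > 0"
      then obtain N where N: "\<And>n. n \<ge> N \<Longrightarrow> e n < \<epsilon> / 2"
        using order_tendstoD(2)[OF e_lim, of "\<epsilon> / 2"] unfolding eventually_sequentially by auto
      have "d (s n) (s n') < \<epsilon>" if "N \<le> n" "N \<le> n'" for n n'
        using s(2) N[OF that(1)] N[OF that(2)] unfolding good_def by (smt (verit) field_sum_of_halves)
      then show "\<exists>N. \<forall>n n'. N \<le> n \<longrightarrow> N \<le> n' \<longrightarrow> d (s n) (s n') < \<epsilon>" by blast
    qed (rule s(1))
    then obtain x where x: "limitin mtopology s x sequentially"
      using \<open>mcomplete\<close> unfolding mcomplete_def by blast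
    then have xM: "x \<in> M" using limitin_topspace by fastforce
    have dx: "(\<lambda>n. d (s n) x) \<longlonglongrightarrow> 0"
      using x by (simp add: limitin_metric_dist_null)
    have "x \<in> mtopology closure_of C"
      unfolding metric_closure_of
    proof (intro CollectI conjI allI impI xM)
      fix r :: real assume "r > 0"
      then have "\<forall>\<^sub>F n in sequentially. d (s n) x < r / 2 \<and> e n < r / 2"
        using order_tendstoD(2)[OF dx, of "r / 2"] order_tendstoD(2)[OF e_lim, of "r / 2"]
        by (simp add: eventually_conj_iff)
      then obtain n where n: "d (s n) x < r / 2" "e n < r / 2"
        unfolding eventually_sequentially by blast
      obtain c where c: "c \<in> C" "c \<in> mball (s n) (e n)"
        using s(2) unfolding good_def by blast
      then have "d x c < r"
        using n triangle[of x "s n" c] xM commute[of x "s n"] by auto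
      then show "\<exists>y\<in>C. y \<in> mball x r" using c xM by auto
    qed
    then have "x \<in> C" using C closure_of_closedin by (fastforce simp: closed_sets_def)
    then show ?thesis using dx by blast
  qed
  have code: "\<exists>z. (\<forall>n. d (q (z n)) x < e n) \<and> good C (\<lambda>n. q (z n))"
    if x: "x \<in> C" "C \<in> CL" for x C
  proof -
    have xM: "x \<in> M" using x CL_subset by blast
    obtain z where z: "\<And>n. d (q (z n)) x < e n"
      using q_dense[OF xM e_pos] by metis
    have "good C (\<lambda>n. q (z n))"
      unfolding good_def
    proof (intro conjI allI)
      show "d (q (z n)) (q (z m)) < e n + e m" for n m
        using triangle[of "q (z n)" x "q (z m)"] z[of n] z[of m] xM by (simp add: commute)
      show "C \<inter> mball (q (z n)) (e n) \<noteq> {}" for n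
        using x z[of n] xM by auto
    qed
    then show ?thesis using z by blast
  qed
  have "{C \<in> CL. distance_set d C \<inter> K \<noteq> {}} = fst ` B"
  proof (intro equalityI subsetI)
    fix C assume "C \<in> {C \<in> CL. distance_set d C \<inter> K \<noteq> {}}"
    then obtain x y where C: "C \<in> CL" "x \<in> C" "y \<in> C" "d x y \<in> K"
      unfolding distance_set_def by blast
    then have xyM: "x \<in> M" "y \<in> M" using CL_subset by auto
    obtain z where z: "\<And>n. d (q (z n)) x < e n" "good C (\<lambda>n. q (z n))"
      using code[OF C(2,1)] by blast
    obtain w where w: "\<And>n. d (q (w n)) y < e n" "good C (\<lambda>n. q (w n))"
      using code[OF C(3,1)] by blast
    define u where "u k = (if even k then z (k div 2) else w (k div 2))" for k
    have ab: "a u = (\<lambda>n. q (z n))" "b u = (\<lambda>n. q (w n))"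
      by (auto simp: a_def b_def u_def)
    have "(\<lambda>n. d (q (z n)) x) \<longlonglongrightarrow> 0" "(\<lambda>n. d (q (w n)) y) \<longlonglongrightarrow> 0"
      using z(1) w(1)
      by (auto intro!: tendsto_sandwich[OF _ _ tendsto_const e_lim] always_eventually simp: less_imp_le)
    then have "(\<lambda>n. d (a u n) (b u n)) \<longlonglongrightarrow> d x y"
      unfolding ab using xyM by (intro tendsto_mdist) auto
    then have "(C, u) \<in> B"
      using C z(2) w(2) by (auto simp: B_def space_pair_measure ab dest!: limI)
    then show "C \<in> fst ` B" by force
  next
    fix C assume "C \<in> fst ` B"
    then obtain u where u: "C \<in> CL" "good C (a u)" "good C (b u)"
      "lim (\<lambda>n. d (a u n) (b u n)) \<in> K"
      by (auto simp: B_def space_pair_measure)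
    have M: "range (a u) \<subseteq> M" "range (b u) \<subseteq> M" by (auto simp: a_def b_def)
    obtain x where x: "x \<in> C" "(\<lambda>n. d (a u n) x) \<longlonglongrightarrow> 0"
      using limit[OF u(1) M(1) u(2)] by blast
    obtain y where y: "y \<in> C" "(\<lambda>n. d (b u n) y) \<longlonglongrightarrow> 0"
      using limit[OF u(1) M(2) u(3)] by blast
    have "lim (\<lambda>n. d (a u n) (b u n)) = d x y"
      using x(1) y(1) CL_subset[OF u(1)] by (intro limI tendsto_mdist[OF M(1) x(2) M(2) y(2)]) auto
    then have "d x y \<in> K" using u(4) by simp
    then show "C \<in> {C \<in> CL. distance_set d C \<inter> K \<noteq> {}}"
      using u(1) x(1) y(1) by (auto simp: distance_set_def)
  qed
  then show ?thesis using B unfolding analytic_sets_def by blast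
qed

section \<open>Upper bounds for the complexity of \<open>V_star\<close>\<close>

lemma distance_subset_coanalytic:
  assumes mcomplete "countable A"
  shows "{C \<in> CL. distance_set d C \<subseteq> A} \<in> coanalytic_sets EB"
proof -
  have "{C \<in> CL. distance_set d C \<inter> - A \<noteq> {}} \<in> analytic_sets EB"
    using assms countable_sets_borel[of A] by (intro analytic_meets_borel) auto
  moreover have "space EB - {C \<in> CL. distance_set d C \<subseteq> A} = {C \<in> CL. distance_set d C \<inter> - A \<noteq> {}}"
    by auto
  ultimately show ?thesis by (simp add: coanalytic_sets_def)
qed

text \<open>As \<open>A\<close> is countable, the inclusion is a countable conjunction of analytic
  conditions, one for each singleton.\<close>

lemma superset_distance_analytic:
  assumes mcomplete "countable A" "A \<noteq> {}"
  shows "{C \<in> CL. A \<subseteq> distance_set d C} \<in> analytic_sets EB"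
proof -
  have "(\<Inter>k. {C \<in> CL. distance_set d C \<inter> {from_nat_into A k} \<noteq> {}}) \<in> analytic_sets EB"
    by (intro analytic_sets_INT analytic_meets_borel[OF assms(1)]) auto
  moreover have "(\<Inter>k. {C \<in> CL. distance_set d C \<inter> {from_nat_into A k} \<noteq> {}}) =
      {C \<in> CL. A \<subseteq> distance_set d C}"
    using range_from_nat_into[OF assms(3,2)] by (auto simp: subset_iff) (metis rangeE)
  ultimately show ?thesis by simp
qed

lemma V_star_eq: "V_star M d A =
    {C \<in> CL. A \<subseteq> distance_set d C} \<inter> {C \<in> CL. distance_set d C \<subseteq> A}"
  unfolding V_star_def by auto

lemma V_star_analytic:
  assumes mcomplete "countable A" "A \<noteq> {}" "closed A"
  shows "V_star M d A \<in> analytic_sets EB"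
  unfolding V_star_eq using assms
  by (intro analytic_sets_Int superset_distance_analytic sets_imp_analytic
      sets_distance_subset_closed)

lemma V_star_D2:
  assumes mcomplete "countable A" "A \<noteq> {}"
  shows "V_star M d A \<in> in_class D2_Sigma11 EB"
  using superset_distance_analytic[OF assms] distance_subset_coanalytic[OF assms(1,2)]
  by (auto simp: V_star_eq)

text \<open>An isolated point of \<open>A\<close> is a distance of \<open>C\<close> as soon as some distance of \<open>C\<close> is close to it,
  and this is a Borel condition on \<open>C\<close>.\<close>

lemma V_star_isolated:
  assumes "countable A" "0 \<in> A" "\<And>a. a \<in> A \<Longrightarrow> a \<noteq> 0 \<Longrightarrow> \<not> a islimpt A"
  obtains G where "G \<in> sets EB" "V_star M d A = {C \<in> CL. distance_set d C \<subseteq> A} \<inter> G"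
proof -
  have "\<exists>W. open W \<and> W \<inter> A = {a}" if "a \<in> A" "a \<noteq> 0" for a
    using assms(3)[OF that] that unfolding islimpt_def by blast
  then obtain W where W: "\<And>a. a \<in> A \<Longrightarrow> a \<noteq> 0 \<Longrightarrow> open (W a) \<and> W a \<inter> A = {a}"
    by metis
  \<comment> \<open>The point 0, possibly a limit point of \<open>A\<close>, is left out; it is a
    distance of every nonempty set.\<close>
  define G where "G = {C \<in> CL. \<forall>a\<in>A - {0}. distance_set d C \<inter> W a \<noteq> {}}"
  have pred: "Measurable.pred EB (\<lambda>C. distance_set d C \<inter> W a \<noteq> {})" if "a \<in> A - {0}" for a
    using sets_meets_open W that by (simp add: pred_def)
  have "Measurable.pred EB (\<lambda>C. \<forall>a\<in>A - {0}. distance_set d C \<inter> W a \<noteq> {})"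
    using assms(1) by (intro measurable_pred_countable pred) auto
  then have "G \<in> sets EB"
    by (simp add: pred_def G_def)
  have zero_in: "0 \<in> distance_set d C" if C: "C \<in> CL" for C
  proof -
    obtain x where "x \<in> C" using C by (auto simp: closed_sets_def)
    then show ?thesis using CL_subset[OF C] by (force simp: distance_set_def intro!: exI[of _ x])
  qed
  have "distance_set d C = A \<longleftrightarrow>
      distance_set d C \<subseteq> A \<and> (\<forall>a\<in>A - {0}. distance_set d C \<inter> W a \<noteq> {})"
    if C: "C \<in> CL" for C
  proof (intro iffI conjI ballI)
    fix a assume "distance_set d C = A" "a \<in> A - {0}"
    then show "distance_set d C \<inter> W a \<noteq> {}" using W[of a] by blast
  next
    assume *: "distance_set d C \<subseteq> A \<and> (\<forall>a\<in>A - {0}. distance_set d C \<inter> W a \<noteq> {})"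
    have "a \<in> distance_set d C" if "a \<in> A" for a
    proof (cases "a = 0")
      case False
      then have "distance_set d C \<inter> W a \<noteq> {}" using * that by simp
      then obtain v where v: "v \<in> distance_set d C" "v \<in> W a" by auto
      then have "v \<in> W a \<inter> A" using * by blast
      then show ?thesis using W[OF that False] v by simp
    qed (simp add: zero_in[OF C])
    then show "distance_set d C = A" using * by blast
  qed auto
  then have "V_star M d A = {C \<in> CL. distance_set d C \<subseteq> A} \<inter> G"
    by (auto simp: G_def V_star_def)
  with \<open>G \<in> sets EB\<close> show ?thesis by (rule that)
qed

lemma V_star_coanalytic:
  assumes mcomplete "countable A" "0 \<in> A" "\<And>a. a \<in> A \<Longrightarrow> a \<noteq> 0 \<Longrightarrow> \<not> a islimpt A"
  shows "V_star M d A \<in> coanalytic_sets EB"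
proof -
  obtain G where "G \<in> sets EB" "V_star M d A = {C \<in> CL. distance_set d C \<subseteq> A} \<inter> G"
    using V_star_isolated[OF assms(2-4)] by blast
  then show ?thesis
    using coanalytic_sets_Int_sets[OF distance_subset_coanalytic[OF assms(1,2)]] by simp
qed

text \<open>For closed \<open>A\<close> the inclusion of the distance set in \<open>A\<close> is
  Borel too, since it fails exactly when an open set of reals is hit.\<close>

lemma V_star_borel_closed:
  assumes "countable A" "0 \<in> A" "closed A" "\<And>a. a \<in> A \<Longrightarrow> a \<noteq> 0 \<Longrightarrow> \<not> a islimpt A"
  shows "V_star M d A \<in> sets EB"
proof -
  obtain G where "G \<in> sets EB" "V_star M d A = {C \<in> CL. distance_set d C \<subseteq> A} \<inter> G"
    using V_star_isolated[OF assms(1,2,4)] by blast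
  then show ?thesis
    using sets_distance_subset_closed[OF assms(3)] by simp
qed

text \<open>If no distance lies in \<open>(0, \<epsilon>)\<close>, then a ball of radius \<open>\<epsilon> / 2\<close> contains at most one point of the
  set, so a pair of such balls determines a single distance.\<close>

lemma V_star_borel_discrete:
  assumes "countable A" "A \<subseteq> {0..}" "\<not> 0 islimpt A"
  shows "V_star M d A \<in> sets EB"
proof -
  obtain \<epsilon> where \<epsilon>: "\<epsilon> > 0" "A \<inter> {0<..<\<epsilon>} = {}"
    using assms(3) unfolding islimpt_approachable dist_real_def by force
  define b where "b n = mball (q n) (\<epsilon> / 2)" for n
  define I where "I a k = {a - inverse (real (Suc k))<..<a + inverse (real (Suc k))}" for a k
  have [measurable]: "Measurable.pred EB (\<lambda>C. C \<inter> b n \<noteq> {})" for n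
    unfolding b_def by (rule pred_hit) auto
  have [measurable]: "Measurable.pred EB (meets (b n) (b m) (I a k))" for n m a k
    unfolding b_def I_def by (rule pred_meets) auto
  have [measurable]: "Measurable.pred EB (meets M M {0<..<\<epsilon>})"
    by (rule pred_meets) auto
  \<comment> \<open>The intervals \<open>I a k\<close> shrink to \<open>a\<close>. By the first
    clause each ball holds at most one point of \<open>C\<close>, so meeting all these intervals
    means having distance exactly \<open>a\<close>. The other two clauses then express the two
    inclusions between \<open>A\<close> and the distance set.\<close>
  define R where "R C \<longleftrightarrow> \<not> meets M M {0<..<\<epsilon>} C \<and>
    (\<forall>a\<in>A. \<exists>n m. \<forall>k. meets (b n) (b m) (I a k) C) \<and>
    (\<forall>n m. C \<inter> b n \<noteq> {} \<and> C \<inter> b m \<noteq> {} \<longrightarrow> (\<exists>a\<in>A. \<forall>k. meets (b n) (b m) (I a k) C))" for C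
  have "{C \<in> space EB. R C} \<in> sets EB"
    unfolding R_def using assms(1) by measurable
  moreover have "V_star M d A = {C \<in> space EB. R C}"
  proof -
    have "distance_set d C = A \<longleftrightarrow> R C" if C: "C \<in> CL" for C
    proof -
      have CM: "x \<in> M" if "x \<in> C" for x using that CL_subset[OF C] by auto
      have gap: "meets M M {0<..<\<epsilon>} C \<longleftrightarrow> distance_set d C \<inter> {0<..<\<epsilon>} \<noteq> {}"
        using CM unfolding meets_def distance_set_def by fastforce
      show ?thesis
      proof (cases "meets M M {0<..<\<epsilon>} C")
        case True
        then show ?thesis using \<epsilon>(2) gap unfolding R_def by blast
      next
        case False
        have uniq: "x = x'" if "x \<in> C" "x' \<in> C" "x \<in> b n" "x' \<in> b n" for x x' n
        proof (rule ccontr)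
          assume "x \<noteq> x'"
          then have "d x x' > 0" using CM that by (simp add: mdist_pos_less)
          moreover have "d x x' < \<epsilon>"
            using that triangle[of x "q n" x'] CM by (simp add: b_def commute)
          moreover have "d x x' \<in> distance_set d C"
            using that unfolding distance_set_def by blast
          ultimately show False
            using False gap by auto
        qed
        have cover: "\<exists>n. x \<in> b n" if "x \<in> C" for x
          using q_dense[of x "\<epsilon> / 2"] \<epsilon>(1) CM[OF that] by (auto simp: b_def)
        have eq: "(\<forall>k. meets (b n) (b m) (I a k) C) \<longleftrightarrow> d x y = a"
          if "x \<in> C" "x \<in> b n" "y \<in> C" "y \<in> b m" for n m a x y
        proof
          assume "\<forall>k. meets (b n) (b m) (I a k) C"
          then have "d x y \<in> I a k" for k
            using uniq that unfolding meets_def by blast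
          then have "\<bar>d x y - a\<bar> < inverse (real (Suc k))" for k
            unfolding I_def by (auto simp: abs_less_iff algebra_simps)
          then show "d x y = a"
            by (metis abs_ge_zero eq_iff_diff_eq_0 less_asym reals_Archimedean zero_less_abs_iff)
        next
          assume "d x y = a"
          then show "\<forall>k. meets (b n) (b m) (I a k) C"
            using that unfolding meets_def I_def by (intro allI bexI[of _ x] bexI[of _ y]) auto
        qed
        show ?thesis
        proof
          assume D: "distance_set d C = A"
          show "R C"
            unfolding R_def
          proof (intro conjI ballI allI impI)
            fix a assume "a \<in> A"
            then obtain x y where "x \<in> C" "y \<in> C" "d x y = a"
              using D unfolding distance_set_def by blast
            then show "\<exists>n m. \<forall>k. meets (b n) (b m) (I a k) C"
              using cover eq by metis
          next
            fix n m assume "C \<inter> b n \<noteq> {} \<and> C \<inter> b m \<noteq> {}"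
            then obtain x y where "x \<in> C" "y \<in> C" "x \<in> b n" "y \<in> b m" by blast
            moreover from this have "d x y \<in> A" using D unfolding distance_set_def by blast
            ultimately show "\<exists>a\<in>A. \<forall>k. meets (b n) (b m) (I a k) C"
              using eq by blast
          qed (rule False)
        next
          assume R: "R C"
          show "distance_set d C = A"
          proof (intro equalityI subsetI)
            fix v assume "v \<in> distance_set d C"
            then obtain x y where xy: "x \<in> C" "y \<in> C" "v = d x y"
              unfolding distance_set_def by blast
            obtain n m where "x \<in> b n" "y \<in> b m" using cover xy by meson
            moreover from this obtain a where a: "a \<in> A" "\<forall>k. meets (b n) (b m) (I a k) C"
              using R xy unfolding R_def by blast
            ultimately have "d x y = a" using eq[of x n y m a] xy by blast
            then show "v \<in> A" using a xy by blast
          next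
            fix a assume "a \<in> A"
            then obtain n m where nm: "\<forall>k. meets (b n) (b m) (I a k) C"
              using R unfolding R_def by blast
            then obtain x y where xy: "x \<in> C" "x \<in> b n" "y \<in> C" "y \<in> b m"
              unfolding meets_def by blast
            then have "d x y = a" using eq nm by simp
            then show "a \<in> distance_set d C"
              using xy unfolding distance_set_def by blast
          qed
        qed
      qed
    qed
    then show ?thesis by (auto simp: V_star_def)
  qed
  ultimately show ?thesis by simp
qed

end

section \<open>Countable subspaces of the Urysohn space\<close>

lemma finite_polish_metric:
  assumes "Metric_space N e" "finite N"
  shows "polish_metric N e"
proof -
  interpret Metric_space N e by fact
  have "compact_space mtopology"
    using assms(2) by (simp add: compact_space_def finite_imp_compactin)
  moreover have "separable_space mtopology"
    unfolding separable_space_def using assms(2)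
      closure_of_topspace[of mtopology] by (intro exI[of _ N]) (auto simp: countable_finite)
  ultimately show ?thesis
    unfolding polish_metric_def using compact_space_imp_mcomplete by (auto intro: Metric_space_axioms)
qed

text \<open>Universality supplies a copy of the first \<open>n + 1\<close> points, though in the
  wrong place. Ultrahomogeneity moves its first \<open>n\<close> points onto the given ones, and the
  image of the last point is the required \<open>p\<close>.\<close>

lemma urysohn_one_point_extension:
  fixes n :: nat
  assumes U: "urysohn_space M d" and \<delta>: "Metric_space UNIV \<delta>"
    and f: "\<And>i. i < n \<Longrightarrow> f i \<in> M" "\<And>i j. i < n \<Longrightarrow> j < n \<Longrightarrow> d (f i) (f j) = \<delta> i j"
  shows "\<exists>p\<in>M. \<forall>i<n. d p (f i) = \<delta> n i"
proof -
  interpret D: Metric_space UNIV \<delta> by fact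
  interpret Metric_space M d using U by (simp add: urysohn_space_def polish_metric_def)
  \<comment> \<open>The points are renamed as reals because universality speaks of metric spaces
    carried by sets of reals.\<close>
  define N where "N = real ` {..n}"
  define r where "r x = nat \<lfloor>x\<rfloor>" for x :: real
  define e where "e x y = \<delta> (r x) (r y)" for x y
  have r [simp]: "r (real i) = i" for i by (simp add: r_def)
  have "Metric_space N e"
    by unfold_locales (auto simp: e_def N_def D.commute intro: D.triangle)
  then have "polish_metric N e"
    by (rule finite_polish_metric) (simp add: N_def)
  then obtain h where h: "isometric_embedding N e M d h"
    using U unfolding urysohn_space_def by blast
  have hM: "h (real i) \<in> M" if "i \<le> n" for i
    using h that unfolding isometric_embedding_def N_def by auto
  have hd: "d (h (real i)) (h (real j)) = \<delta> i j" if "i \<le> n" "j \<le> n" for i j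
    using h that unfolding isometric_embedding_def N_def e_def by auto
  define S where "S = (\<lambda>i. h (real i)) ` {..<n}"
  have inj: "inj_on (\<lambda>i. h (real i)) {..<n}"
    by (rule inj_onI) (metis D.zero UNIV_I hM hd lessThan_iff less_imp_le zero)
  define \<phi> where "\<phi> x = f (the_inv_into {..<n} (\<lambda>i. h (real i)) x)" for x
  have \<phi>: "\<phi> (h (real i)) = f i" if "i < n" for i
    using inj that by (simp add: \<phi>_def the_inv_into_f_f[OF inj])
  have "isometric_embedding S d M d \<phi>"
    unfolding isometric_embedding_def S_def using f hd by (auto simp: \<phi>)
  moreover have "finite S" "S \<subseteq> M"
    using hM by (auto simp: S_def)
  ultimately obtain g where g: "isometric_embedding M d M d g" "\<forall>x\<in>S. g x = \<phi> x"
    using U unfolding urysohn_space_def by blast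
  have "d (g (h (real n))) (f i) = \<delta> n i" if "i < n" for i
  proof -
    have "g (h (real i)) = f i" using g(2) \<phi> that by (auto simp: S_def)
    moreover have "d (g (h (real n))) (g (h (real i))) = d (h (real n)) (h (real i))"
      using g(1) hM that unfolding isometric_embedding_def by auto
    ultimately show ?thesis using hd[of n i] that by simp
  qed
  moreover have "g (h (real n)) \<in> M"
    using g(1) hM unfolding isometric_embedding_def by auto
  ultimately show ?thesis by blast
qed

text \<open>The points are chosen one after another, each extending the finite subspace already
  embedded.\<close>

lemma urysohn_embeds_nat:
  fixes M :: "'a set"
  assumes U: "urysohn_space M d" and \<delta>: "Metric_space (UNIV :: nat set) \<delta>"
  shows "\<exists>f. range f \<subseteq> M \<and> (\<forall>i j. d (f i) (f j) = \<delta> i j)"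
proof -
  interpret D: Metric_space UNIV \<delta> by fact
  interpret Metric_space M d using U by (simp add: urysohn_space_def polish_metric_def)
  have "\<exists>f. \<forall>n. f n \<in> M \<and> (\<forall>i<n. d (f n) (f i) = \<delta> n i)"
  proof (rule dependent_wellorder_choice)
    fix r and f g :: "nat \<Rightarrow> 'a" and n :: nat
    assume "\<And>y. y < n \<Longrightarrow> f y = g y"
    then show "(r \<in> M \<and> (\<forall>i<n. d r (f i) = \<delta> n i)) = (r \<in> M \<and> (\<forall>i<n. d r (g i) = \<delta> n i))"
      by auto
  next
    fix n f assume *: "\<And>y. y < n \<Longrightarrow> f y \<in> M \<and> (\<forall>i<y. d (f y) (f i) = \<delta> y i)"
    have "d (f i) (f j) = \<delta> i j" if "i < n" "j < n" for i j
      using *[OF that(1)] *[OF that(2)] commute[of "f i" "f j"] D.commute[of i j]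
      by (cases i j rule: linorder_cases) auto
    then show "\<exists>r. r \<in> M \<and> (\<forall>i<n. d r (f i) = \<delta> n i)"
      using urysohn_one_point_extension[OF U \<delta>, of n f] * by blast
  qed
  then obtain f where f: "\<And>n. f n \<in> M" "\<And>n i. i < n \<Longrightarrow> d (f n) (f i) = \<delta> n i"
    by blast
  have "d (f i) (f j) = \<delta> i j" for i j
    using f(2)[of i j] f(2)[of j i] f(1) commute[of "f i" "f j"] D.commute[of i j]
    by (cases i j rule: linorder_cases) auto
  then show ?thesis using f(1) by auto
qed

lemma urysohn_embeds_countable:
  fixes \<delta> :: "'p::countable \<Rightarrow> 'p \<Rightarrow> real"
  assumes U: "urysohn_space M d" and \<delta>: "Metric_space UNIV \<delta>" and inf: "infinite (UNIV :: 'p set)"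
  obtains f where "\<And>x. f x \<in> M" "\<And>x y. d (f x) (f y) = \<delta> x y"
proof -
  interpret D: Metric_space UNIV \<delta> by fact
  obtain b :: "nat \<Rightarrow> 'p" where b: "bij b"
    using bij_betw_from_nat_into[OF countableI_type inf] by blast
  have "Metric_space UNIV (\<lambda>i j. \<delta> (b i) (b j))"
    using b by unfold_locales (auto simp: D.commute bij_def inj_def intro: D.triangle)
  from urysohn_embeds_nat[OF U this] obtain f where
    f: "range f \<subseteq> M" "\<And>i j. d (f i) (f j) = \<delta> (b i) (b j)" by blast
  show ?thesis
    using f b by (intro that[of "\<lambda>x. f (inv b x)"]) (auto simp: bij_def surj_f_inv_f)
qed

section \<open>Tree spaces\<close>

text \<open>The length of the longest common prefix.\<close>

fun meet :: "'a list \<Rightarrow> 'a list \<Rightarrow> nat" where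
  "meet (x # s) (y # t) = (if x = y then Suc (meet s t) else 0)"
| "meet _ _ = 0"

lemma le_meet_iff: "n \<le> meet s t \<longleftrightarrow> n \<le> length s \<and> n \<le> length t \<and> take n s = take n t"
proof (induction s t arbitrary: n rule: meet.induct)
  case (1 x s y t)
  then show ?case by (cases n) auto
qed auto

lemma meet_self [simp]: "meet s s = length s"
  by (induction s) auto

lemma meet_commute: "meet s t = meet t s"
  by (induction s t rule: meet.induct) auto

text \<open>Agreement on the first \<open>n\<close> entries is transitive; this is the ultrametric
  inequality for trees.\<close>

lemma meet_ultra: "min (meet s t) (meet t u) \<le> meet s u"
proof -
  define n where "n = min (meet s t) (meet t u)"
  have "n \<le> meet s t" "n \<le> meet t u" by (auto simp: n_def)
  then have "n \<le> meet s u" unfolding le_meet_iff by simp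
  then show ?thesis by (simp add: n_def)
qed

text \<open>\<open>(i, b, s)\<close> is the node \<open>s\<close> in the copy \<open>b\<close> of the \<open>i\<close>-th tree.\<close>

type_synonym point = "nat \<times> bool \<times> nat list"

text \<open>\<open>r i\<close> is the distance controlled by tree \<open>i\<close>, and
  \<open>c\<close> separates different pieces. By \<open>eps_le\<close> points of one copy are
  clearly closer than points of different copies; by \<open>rho_approx\<close> the values
  \<open>\<rho> i n\<close> vary slowly enough for the triangle inequality.\<close>

locale tree_pieces =
  fixes c :: real and \<epsilon> \<rho> :: "nat \<Rightarrow> nat \<Rightarrow> real" and r :: "nat \<Rightarrow> real"
  assumes c_pos: "c > 0"
    and eps_pos: "\<epsilon> i n > 0"
    and eps_Suc: "\<epsilon> i (Suc n) \<le> \<epsilon> i n"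
    and eps_lim: "\<epsilon> i \<longlonglongrightarrow> 0"
    and eps_le: "\<epsilon> i 0 \<le> r i / 2"
    and rho_approx: "\<bar>\<rho> i n - r i\<bar> \<le> \<epsilon> i n / 2"
begin

section \<open>The metric on the union of the pieces\<close>

lemma eps_antimono: "m \<le> n \<Longrightarrow> \<epsilon> i n \<le> \<epsilon> i m"
  using eps_Suc by (rule lift_Suc_antimono_le)

lemma rho_bounds: "3 / 4 * r i \<le> \<rho> i n" "\<rho> i n \<le> 5 / 4 * r i"
  using rho_approx[of i n] eps_antimono[of 0 n i] eps_le[of i] by linarith+

lemma eps_le_r: "\<epsilon> i n \<le> r i / 2"
  using eps_antimono[of 0 n i] eps_le[of i] by linarith

lemma r_pos: "r i > 0"
  using eps_le[of i] eps_pos[of i 0] by linarith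

lemma rho_pos: "\<rho> i n > 0"
  using rho_bounds(1)[of i n] r_pos[of i] by linarith

lemma rho_diff: "k \<le> m \<Longrightarrow> k \<le> n \<Longrightarrow> \<bar>\<rho> i m - \<rho> i n\<bar> \<le> \<epsilon> i k"
  using rho_approx[of i m] rho_approx[of i n] eps_antimono[of k m i] eps_antimono[of k n i]
  by linarith

text \<open>A maximum introduces no value beyond \<open>c\<close> and the \<open>\<rho> i 0\<close>.
  It is at least half the bound \<open>2 * \<rho> i 0\<close> on the diameter of either piece, so a
  detour through another piece is never too short.\<close>

definition cross :: "nat \<Rightarrow> nat \<Rightarrow> real" where
  "cross i j = max c (max (\<rho> i 0) (\<rho> j 0))"

fun \<delta> :: "point \<Rightarrow> point \<Rightarrow> real" where
  "\<delta> (i, b, s) (j, b', t) =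
    (if i \<noteq> j then cross i j
     else if b \<noteq> b' then \<rho> i (meet s t)
     else if s = t then 0 else \<epsilon> i (meet s t))"

declare \<delta>.simps [simp del]

lemma delta_cross: "i \<noteq> j \<Longrightarrow> \<delta> (i, b, s) (j, b', t) = cross i j"
  and delta_rho: "b \<noteq> b' \<Longrightarrow> \<delta> (i, b, s) (i, b', t) = \<rho> i (meet s t)"
  and delta_eps: "s \<noteq> t \<Longrightarrow> \<delta> (i, b, s) (i, b, t) = \<epsilon> i (meet s t)"
  and delta_self: "\<delta> (i, b, s) (i, b, s) = 0"
  by (auto simp: \<delta>.simps)

lemma delta_piece_le: "\<delta> (i, b, s) (i, b', t) \<le> 2 * \<rho> i 0"
  using rho_bounds(1)[of i 0] rho_bounds(2)[of i "meet s t"] eps_le_r[of i "meet s t"] r_pos[of i]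
  by (auto simp: \<delta>.simps)

lemma delta_nonneg: "0 \<le> \<delta> p p'"
  using c_pos rho_pos eps_pos
  by (cases p, cases p') (auto simp: \<delta>.simps cross_def max_def intro: less_imp_le)

lemma delta_commute: "\<delta> p p' = \<delta> p' p"
  by (cases p, cases p') (auto simp: \<delta>.simps cross_def meet_commute max.commute)

lemma delta_eq_0: "\<delta> p p' = 0 \<longleftrightarrow> p = p'"
proof (cases p, cases p')
  fix i b s j b' t assume p: "p = (i, b, s)" "p' = (j, b', t)"
  have "cross i j > 0" using c_pos by (simp add: cross_def)
  then show ?thesis
    using rho_pos[of i "meet s t"] eps_pos[of i "meet s t"] unfolding p by (auto simp: \<delta>.simps)
qed

text \<open>Either \<open>u\<close> agrees with both \<open>s\<close> and \<open>t\<close> at least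
  as far as they agree with each other, and \<open>rho_diff\<close> applies, or \<open>u\<close>
  leaves both at the same level and the two values coincide.\<close>

lemma rho_lipschitz:
  assumes "s \<noteq> t"
  shows "\<bar>\<rho> i (meet s u) - \<rho> i (meet t u)\<bar> \<le> \<epsilon> i (meet s t)"
proof (cases "meet s t \<le> meet s u \<and> meet s t \<le> meet t u")
  case True
  then show ?thesis by (simp add: rho_diff)
next
  case False
  then have "meet s u = meet t u"
    using meet_ultra[of s t u] meet_ultra[of t s u] meet_commute[of s t] by linarith
  then show ?thesis using eps_pos[of i "meet s t"] by simp
qed

text \<open>A detour through the other copy costs at least \<open>3 / 2 * r i\<close>, more than any
  distance within a copy. Inside one copy the metric is an ultrametric, and the mixed cases are
  \<open>rho_lipschitz\<close>.\<close>

lemma delta_piece_triangle: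
  "\<delta> (i, b, s) (i, b'', u) \<le> \<delta> (i, b, s) (i, b', t) + \<delta> (i, b', t) (i, b'', u)"
proof -
  consider "s = u" "b = b''" | "(i, b, s) = (i, b', t)" | "(i, b', t) = (i, b'', u)"
    | "b = b''" "b' \<noteq> b" "s \<noteq> u"
    | "b = b''" "b' = b" "s \<noteq> t" "t \<noteq> u" "s \<noteq> u"
    | "b \<noteq> b''" "b' = b" "s \<noteq> t"
    | "b \<noteq> b''" "b' = b''" "t \<noteq> u"
    by auto
  then show ?thesis
  proof cases
    case 1
    then show ?thesis using delta_nonneg[of "(i, b, s)"] delta_nonneg[of "(i, b', t)"]
      by (simp add: delta_self add_nonneg_nonneg)
  next
    case 2
    then show ?thesis using delta_nonneg[of "(i, b, s)"] by (simp add: delta_self)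
  next
    case 3
    then show ?thesis using delta_nonneg[of "(i, b, s)"] by (simp add: delta_self)
  next
    case 4
    then show ?thesis
      using eps_le_r[of i "meet s u"] rho_bounds(1)[of i "meet s t"] rho_bounds(1)[of i "meet t u"]
        r_pos[of i] by (simp add: delta_eps delta_rho)
  next
    case 5
    have "\<epsilon> i (meet s u) \<le> \<epsilon> i (min (meet s t) (meet t u))"
      by (rule eps_antimono[OF meet_ultra])
    also have "\<dots> \<le> \<epsilon> i (meet s t) + \<epsilon> i (meet t u)"
      using eps_pos[of i "meet s t"] eps_pos[of i "meet t u"] by (simp add: min_def)
    finally show ?thesis using 5 by (simp add: delta_eps)
  next
    case 6
    then show ?thesis using rho_lipschitz[of s t i u] by (simp add: delta_eps delta_rho)
  next
    case 7
    then show ?thesis using rho_lipschitz[of t u i s]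
      by (simp add: delta_eps delta_rho meet_commute[of s])
  qed
qed

lemma delta_triangle: "\<delta> p p'' \<le> \<delta> p p' + \<delta> p' p''"
proof (cases p, cases p', cases p'')
  fix i b s j b' t k b'' u
  assume p: "p = (i, b, s)" "p' = (j, b', t)" "p'' = (k, b'', u)"
  consider "i = j" "j = k" | "i = j" "j \<noteq> k" | "i \<noteq> j" "j = k" | "i \<noteq> j" "j \<noteq> k" "i = k"
    | "i \<noteq> j" "j \<noteq> k" "i \<noteq> k" by auto
  then show ?thesis
  proof cases
    case 1
    then show ?thesis unfolding p using delta_piece_triangle by simp
  next
    case 2
    then show ?thesis unfolding p using delta_nonneg[of "(j, b, s)"] by (simp add: delta_cross)
  next
    case 3
    then show ?thesis unfolding p using delta_nonneg[of "(k, b', t)"] by (simp add: delta_cross)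
  next
    case 4
    have "\<delta> (k, b, s) (k, b'', u) \<le> cross k j + cross j k"
      using delta_piece_le[of k b s b'' u] by (auto simp: cross_def max_def)
    then show ?thesis using 4 unfolding p by (simp add: delta_cross)
  next
    case 5
    have "cross i k \<le> cross i j + cross j k"
      using c_pos rho_pos[of i 0] rho_pos[of j 0] rho_pos[of k 0] by (auto simp: cross_def max_def)
    then show ?thesis using 5 unfolding p by (simp add: delta_cross)
  qed
qed

lemma Metric_space_delta: "Metric_space UNIV \<delta>"
  by unfold_locales (auto simp: delta_nonneg delta_eq_0 delta_triangle intro: delta_commute)

end

definition illfounded :: "nat list set \<Rightarrow> bool" where
  "illfounded S \<longleftrightarrow> (\<exists>\<alpha>. \<forall>n. map \<alpha> [0..<n] \<in> S)"

locale embedded_tree_pieces = tree_pieces c \<epsilon> \<rho> r + Metric_space M d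
  for c \<epsilon> \<rho> r and M :: "'a set" and d +
  fixes f :: "point \<Rightarrow> 'a"
  assumes f_in [simp]: "f p \<in> M"
    and d_f [simp]: "d (f p) (f p') = \<delta> p p'"
    and complete: mcomplete
begin

section \<open>Distances realised in the closures of embedded trees\<close>

definition nodes :: "(nat \<Rightarrow> nat list set) \<Rightarrow> point set" where
  "nodes T = {(i, b, s). s \<in> T i}"

text \<open>As \<open>M\<close> is complete, this closure is a completion of the space of nodes. The
  embedding \<open>f\<close> is the same for all \<open>T\<close>, so only the choice of nodes
  varies with \<open>T\<close>.\<close>

definition tree_space :: "(nat \<Rightarrow> nat list set) \<Rightarrow> 'a set" where
  "tree_space T = mtopology closure_of (f ` nodes T)"

lemma tree_space_in_M: "x \<in> tree_space T \<Longrightarrow> x \<in> M"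
  unfolding tree_space_def by (simp add: metric_closure_of)

lemma tree_space_superset: "p \<in> nodes T \<Longrightarrow> f p \<in> tree_space T"
  unfolding tree_space_def
  by (rule subsetD[OF closure_of_subset]) auto

lemma tree_space_approx:
  assumes "x \<in> tree_space T" "\<eta> > 0"
  shows "\<exists>i b s. s \<in> T i \<and> d x (f (i, b, s)) < \<eta>"
  using assms unfolding tree_space_def metric_closure_of nodes_def by fastforce

lemma tree_space_closed:
  assumes "[] \<in> T 0"
  shows "tree_space T \<in> closed_sets mtopology"
proof -
  have "(0, True, []) \<in> nodes T" using assms by (simp add: nodes_def)
  then have "tree_space T \<noteq> {}" using tree_space_superset by blast
  then show ?thesis
    unfolding closed_sets_def tree_space_def by simp
qed

text \<open>Hitting an open set becomes a countable disjunction over nodes, which makes the closure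
  depend measurably on the trees.\<close>

lemma tree_space_hit:
  assumes "openin mtopology U"
  shows "tree_space T \<inter> U \<noteq> {} \<longleftrightarrow> (\<exists>i b s. s \<in> T i \<and> f (i, b, s) \<in> U)"
proof -
  have "U \<inter> tree_space T = {} \<longleftrightarrow> U \<inter> f ` nodes T = {}"
    unfolding tree_space_def by (rule openin_Int_closure_of_eq_empty[OF assms])
  then show ?thesis by (auto simp: nodes_def)
qed

lemma distance_delta:
  assumes "s \<in> T i" "t \<in> T j"
  shows "\<delta> (i, b, s) (j, b', t) \<in> distance_set d (tree_space T)"
proof -
  have "f (i, b, s) \<in> tree_space T" "f (j, b', t) \<in> tree_space T"
    using assms by (auto intro!: tree_space_superset simp: nodes_def)
  then show ?thesis unfolding distance_set_def using d_f by (metis (mono_tags, lifting) mem_Collect_eq)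
qed

text \<open>Along an infinite branch the nodes of each copy form a Cauchy sequence. The distance of
  the two limits is the limit of \<open>\<rho> i n\<close>, which is \<open>r i\<close>.\<close>

lemma distance_illfounded:
  assumes "illfounded (T i)"
  shows "r i \<in> distance_set d (tree_space T)"
proof -
  obtain \<alpha> where \<alpha>: "\<And>n. map \<alpha> [0..<n] \<in> T i"
    using assms unfolding illfounded_def by blast
  define s where "s b n = f (i, b, map \<alpha> [0..<n])" for b n
  have sM: "range (s b) \<subseteq> M" for b by (auto simp: s_def)
  have meet: "meet (map \<alpha> [0..<m]) (map \<alpha> [0..<n]) \<ge> min m n" for m n
    by (simp add: le_meet_iff take_map min_def)
  have near: "d (s b m) (s b n) \<le> \<epsilon> i k" if "k \<le> m" "k \<le> n" for b m n k
    using eps_antimono[of k "meet (map \<alpha> [0..<m]) (map \<alpha> [0..<n])" i] meet[of m n] that eps_pos[of i k]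
    by (auto simp: s_def \<delta>.simps)
  have ex: "\<exists>x\<in>tree_space T. (\<lambda>n. d (s b n) x) \<longlonglongrightarrow> 0" for b
  proof -
    have "MCauchy (s b)"
      unfolding MCauchy_def
    proof (intro conjI allI impI sM)
      fix e :: real assume "e > 0"
      then obtain k where "\<epsilon> i k < e"
        using order_tendstoD(2)[OF eps_lim] unfolding eventually_sequentially by blast
      then show "\<exists>N. \<forall>n n'. N \<le> n \<longrightarrow> N \<le> n' \<longrightarrow> d (s b n) (s b n') < e"
        using near by (meson le_less_trans)
    qed
    then obtain x where x: "limitin mtopology (s b) x sequentially"
      using complete unfolding mcomplete_def by blast
    then have xM: "x \<in> M" using limitin_topspace by fastforce
    have dx: "(\<lambda>n. d (s b n) x) \<longlonglongrightarrow> 0"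
      using x by (simp add: limitin_metric_dist_null)
    have "x \<in> tree_space T"
      unfolding tree_space_def metric_closure_of
    proof (intro CollectI conjI allI impI xM)
      fix e :: real assume "e > 0"
      then obtain n where "d (s b n) x < e"
        using order_tendstoD(2)[OF dx] unfolding eventually_sequentially by blast
      moreover have "s b n \<in> f ` nodes T" using \<alpha> by (auto simp: s_def nodes_def)
      ultimately show "\<exists>y\<in>f ` nodes T. y \<in> mball x e"
        using xM sM[of b] by (auto simp: commute intro!: bexI[of _ "s b n"])
    qed
    then show ?thesis using dx by blast
  qed
  obtain x where x: "x \<in> tree_space T" "(\<lambda>n. d (s False n) x) \<longlonglongrightarrow> 0" using ex by blast
  obtain y where y: "y \<in> tree_space T" "(\<lambda>n. d (s True n) y) \<longlonglongrightarrow> 0" using ex by blast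
  have "(\<lambda>n. d (s False n) (s True n)) \<longlonglongrightarrow> d x y"
    using x y sM tree_space_in_M by (intro tendsto_mdist) auto
  moreover have "(\<lambda>n. d (s False n) (s True n)) = \<rho> i"
    by (auto simp: s_def delta_rho)
  moreover have "\<rho> i \<longlonglongrightarrow> r i"
  proof -
    have "(\<lambda>n. \<rho> i n - r i) \<longlonglongrightarrow> 0"
      by (rule Lim_null_comparison[of _ "\<lambda>n. \<epsilon> i n / 2"])
        (use rho_approx tendsto_divide[OF eps_lim tendsto_const, of 2] in auto)
    then show ?thesis by (simp add: LIM_zero_iff)
  qed
  ultimately have "r i = d x y" using LIMSEQ_unique by metis
  then show ?thesis using x(1) y(1) unfolding distance_set_def by blast
qed

text \<open>A distance not of the form \<open>\<delta> p p'\<close>, for any nodes at all, can only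
  be approximated by pairs from the two copies of one tree whose common prefixes grow without bound.
  Hence it is \<open>r i\<close>, and the approximating nodes produce a branch.\<close>

lemma distance_cases:
  assumes v: "v \<in> distance_set d (tree_space T)" and v_notin: "\<And>p p'. v \<noteq> \<delta> p p'"
    and T: "\<And>i s n. s \<in> T i \<Longrightarrow> take n s \<in> T i"
  obtains i where "v = r i" "illfounded (T i)"
proof -
  obtain x y where xy: "x \<in> tree_space T" "y \<in> tree_space T" "v = d x y"
    using v unfolding distance_set_def by blast
  have M: "x \<in> M" "y \<in> M" using xy tree_space_in_M by auto
  have approx: "\<bar>v - \<delta> p p'\<bar> < 2 * \<eta>" if "d x (f p) < \<eta>" "d y (f p') < \<eta>" for p p' \<eta>
    using that triangle[of x "f p" y] triangle[of "f p" "f p'" y] triangle[of "f p" x "f p'"]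
      triangle[of x y "f p'"] M commute[of "f p'" y] commute[of "f p" x] xy(3) by simp
  \<comment> \<open>Nodes near a common point belong to one piece, since different pieces are at
    least \<open>c\<close> apart.\<close>
  have same: "fst p = fst p'" if "d z (f p) < c / 4" "d z (f p') < c / 4" "z \<in> M" for z p p'
  proof (rule ccontr)
    assume ne: "fst p \<noteq> fst p'"
    have "\<delta> p p' < c"
      using triangle[of "f p" z "f p'"] that c_pos commute[of "f p" z] by simp
    moreover have "c \<le> \<delta> p p'"
      using ne by (cases p, cases p') (auto simp: delta_cross cross_def)
    ultimately show False by simp
  qed
  obtain i b0 s0 where i: "d x (f (i, b0, s0)) < c / 4"
    using tree_space_approx[OF xy(1), of "c / 4"] c_pos by auto
  obtain j b1 t0 where j: "d y (f (j, b1, t0)) < c / 4"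
    using tree_space_approx[OF xy(2), of "c / 4"] c_pos by auto
  have near_x: "\<exists>b s. s \<in> T i \<and> d x (f (i, b, s)) < \<eta>" if \<eta>: "0 < \<eta>" "\<eta> \<le> c / 4" for \<eta>
  proof -
    obtain k b s where k: "s \<in> T k" "d x (f (k, b, s)) < \<eta>"
      using tree_space_approx[OF xy(1) \<eta>(1)] by blast
    then have "k = i" using same[OF _ i, of "(k, b, s)"] \<eta> M by simp
    then show ?thesis using k by blast
  qed
  have near_y: "\<exists>b s. s \<in> T j \<and> d y (f (j, b, s)) < \<eta>" if \<eta>: "0 < \<eta>" "\<eta> \<le> c / 4" for \<eta>
  proof -
    obtain k b s where k: "s \<in> T k" "d y (f (k, b, s)) < \<eta>"
      using tree_space_approx[OF xy(2) \<eta>(1)] by blast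
    then have "k = j" using same[OF _ j, of "(k, b, s)"] \<eta> M by simp
    then show ?thesis using k by blast
  qed
  have ij: "j = i"
  proof (rule ccontr)
    assume "j \<noteq> i"
    \<comment> \<open>All distances between two different pieces equal the one number
      \<open>cross i j\<close>, so a value approximated by them would be that number.\<close>
    define \<eta> where "\<eta> = min (c / 4) (\<bar>v - cross i j\<bar> / 2)"
    have "v \<noteq> cross i j"
      using v_notin[of "(i, True, [])" "(j, True, [])"] \<open>j \<noteq> i\<close> by (simp add: delta_cross)
    then have \<eta>: "0 < \<eta>" "\<eta> \<le> c / 4" "2 * \<eta> \<le> \<bar>v - cross i j\<bar>"
      using c_pos by (auto simp: \<eta>_def min_def)
    obtain b s where "d x (f (i, b, s)) < \<eta>" using near_x[OF \<eta>(1,2)] by blast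
    moreover obtain b' t where "d y (f (j, b', t)) < \<eta>" using near_y[OF \<eta>(1,2)] by blast
    ultimately show False
      using approx[of "(i, b, s)" \<eta> "(j, b', t)"] \<eta>(3) \<open>j \<noteq> i\<close> by (simp add: delta_cross)
  qed
  have node: "\<exists>b s. s \<in> T i \<and> n < length s \<and> d x (f (i, b, s)) < \<epsilon> i n / 4 \<and> \<bar>v - r i\<bar> \<le> \<epsilon> i n" for n
  proof -
    \<comment> \<open>The closed set of all values of \<open>\<delta>\<close> within piece
      \<open>i\<close>, apart from those of nodes in different copies with a common prefix longer
      than \<open>n\<close>. The limit 0 of the \<open>\<epsilon> i k\<close> belongs to it.\<close>
    define F where "F = insert 0 (range (\<epsilon> i)) \<union> \<rho> i ` {..n}"
    have "closed F"
      unfolding F_def using compact_sequence_with_limit[OF eps_lim[of i]]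
      by (intro closed_Un compact_imp_closed) (auto intro: finite_imp_compact)
    moreover have "v \<notin> F"
    proof -
      have "v \<noteq> 0" using v_notin[of "(i, True, [])" "(i, True, [])"] by (simp add: delta_self)
      moreover have "v \<noteq> \<rho> i k" for k
        using v_notin[of "(i, True, replicate k 0)" "(i, False, replicate k 0)"] by (simp add: delta_rho)
      moreover have "v \<noteq> \<epsilon> i k" for k
      proof -
        have "meet (replicate k 0) (replicate k 0 @ [0 :: nat]) = k"
          by (induction k) auto
        then show ?thesis
          using v_notin[of "(i, True, replicate k 0)" "(i, True, replicate k 0 @ [0])"]
          by (simp add: delta_eps)
      qed
      ultimately show ?thesis by (auto simp: F_def)
    qed
    ultimately obtain \<gamma> where \<gamma>: "\<gamma> > 0" "\<And>w. w \<in> F \<Longrightarrow> \<gamma> \<le> \<bar>v - w\<bar>"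
      using separate_point_closed[of F v] unfolding dist_real_def by blast
    \<comment> \<open>The bound \<open>\<gamma> / 2\<close> keeps the approximating distance out of
      \<open>F\<close>; the bound \<open>\<epsilon> i n / 4\<close> yields the two estimates claimed
      by \<open>node\<close>.\<close>
    define \<eta> where "\<eta> = min (c / 4) (min (\<epsilon> i n / 4) (\<gamma> / 2))"
    have \<eta>: "0 < \<eta>" "\<eta> \<le> c / 4" "\<eta> \<le> \<epsilon> i n / 4" "2 * \<eta> \<le> \<gamma>"
      using c_pos eps_pos[of i n] \<gamma>(1) by (auto simp: \<eta>_def min_def)
    obtain b s where s: "s \<in> T i" "d x (f (i, b, s)) < \<eta>" using near_x[OF \<eta>(1,2)] by blast
    obtain b' t where t: "d y (f (i, b', t)) < \<eta>" using near_y[OF \<eta>(1,2)] ij by blast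
    have *: "\<bar>v - \<delta> (i, b, s) (i, b', t)\<bar> < 2 * \<eta>" by (rule approx[OF s(2) t])
    have notF: "\<delta> (i, b, s) (i, b', t) \<notin> F" using \<gamma>(2) \<eta>(4) * by fastforce
    then have "b \<noteq> b'" by (auto simp: F_def \<delta>.simps split: if_splits)
    then have D: "\<delta> (i, b, s) (i, b', t) = \<rho> i (meet s t)" by (rule delta_rho)
    have "n < meet s t" using notF unfolding D F_def by (auto simp: not_less)
    moreover have "meet s t \<le> length s" using le_meet_iff by blast
    moreover have "\<bar>v - r i\<bar> \<le> \<epsilon> i n"
      using * \<eta>(3) rho_approx[of i "meet s t"] eps_antimono[of n "meet s t" i] \<open>n < meet s t\<close>
      unfolding D by linarith
    ultimately show ?thesis using s \<eta>(3) by (meson less_le_trans order.strict_trans1 le_less_trans)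
  qed
  have "v = r i"
  proof (rule ccontr)
    assume "v \<noteq> r i"
    then obtain n where "\<epsilon> i n < \<bar>v - r i\<bar>"
      using order_tendstoD(2)[OF eps_lim[of i], of "\<bar>v - r i\<bar>"] unfolding eventually_sequentially by auto
    then show False using node[of n] by auto
  qed
  obtain b s where s: "\<And>n. s n \<in> T i" "\<And>n. n < length (s n)" "\<And>n. d x (f (i, b n, s n)) < \<epsilon> i n / 4"
    using node by metis
  \<comment> \<open>The nodes for \<open>n\<close> and \<open>m\<close> are both close to
    \<open>x\<close>, hence less than \<open>\<epsilon> i n\<close> apart. Different copies are
    farther apart than that, and within one copy monotonicity of \<open>\<epsilon> i\<close> forces
    a common prefix longer than \<open>n\<close>.\<close>
  have agree: "take (Suc n) (s n) = take (Suc n) (s m)" if "n \<le> m" for n m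
  proof -
    have D: "\<delta> (i, b n, s n) (i, b m, s m) < \<epsilon> i n"
      using triangle[of "f (i, b n, s n)" x "f (i, b m, s m)"] s(3)[of n] s(3)[of m] M
        eps_antimono[OF that, of i] eps_pos[of i n] commute[of "f (i, b n, s n)" x] by simp
    have "b n = b m"
    proof (rule ccontr)
      assume "b n \<noteq> b m"
      then show False
        using D rho_bounds(1)[of i "meet (s n) (s m)"] eps_le_r[of i n] r_pos[of i]
        by (simp add: delta_rho)
    qed
    show ?thesis
    proof (cases "s n = s m")
      case False
      then have "\<epsilon> i (meet (s n) (s m)) < \<epsilon> i n" using D \<open>b n = b m\<close> by (simp add: delta_eps)
      then have "n < meet (s n) (s m)"
        using eps_antimono[of "meet (s n) (s m)" n i] by (meson not_le)
      then show ?thesis using le_meet_iff[of "Suc n" "s n" "s m"] by simp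
    qed simp
  qed
  \<comment> \<open>The diagonal entry is stable: every later node has the same entry at position
    \<open>n\<close>.\<close>
  define \<alpha> where "\<alpha> n = s n ! n" for n
  have "map \<alpha> [0..<n] = take n (s n)" for n
  proof (rule nth_equalityI)
    show "length (map \<alpha> [0..<n]) = length (take n (s n))" using s(2)[of n] by simp
  next
    fix k assume "k < length (map \<alpha> [0..<n])"
    then have "k < n" by simp
    have "s k ! k = take (Suc k) (s k) ! k" by simp
    also have "\<dots> = take (Suc k) (s n) ! k" using agree[of k n] \<open>k < n\<close> by simp
    finally show "map \<alpha> [0..<n] ! k = take n (s n) ! k" using \<open>k < n\<close> by (simp add: \<alpha>_def)
  qed
  then have "illfounded (T i)"
    unfolding illfounded_def using T s(1) by metis
  then show ?thesis using that \<open>v = r i\<close> by blast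
qed

end

section \<open>Completeness\<close>

lemma polish_metric_dense_sequence:
  assumes "polish_metric M d" "M \<noteq> {}"
  obtains q where "metric_with_dense_sequence M d q"
proof -
  interpret Metric_space M d using assms(1) by (simp add: polish_metric_def)
  obtain C where C: "countable C" "C \<subseteq> M" "mtopology closure_of C = M"
    using assms(1) unfolding polish_metric_def separable_space_def by auto
  then have "C \<noteq> {}" using assms(2) by auto
  then have range: "range (from_nat_into C) = C" using C(1) by (rule range_from_nat_into)
  have "metric_with_dense_sequence M d (from_nat_into C)"
  proof
    show "from_nat_into C n \<in> M" for n using range C(2) by blast
    fix x e assume "x \<in> M" "0 < (e :: real)"
    then have "\<exists>y\<in>C. y \<in> mball x e" using C(3) unfolding metric_closure_of by blast
    then obtain y where "y \<in> C" "d y x < e" by (auto simp: commute)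
    then show "\<exists>n. d (from_nat_into C n) x < e" using range by (metis rangeE)
  qed
  then show ?thesis by (rule that)
qed

text \<open>\<open>\<epsilon>\<close> is chosen recursively from elements of \<open>A\<close> near
  0. If \<open>r\<close> belongs to \<open>A\<close>, then \<open>\<rho>\<close> is constantly
  \<open>r\<close>, so that the two roots realise \<open>r\<close>; otherwise it approximates
  \<open>r\<close> from inside \<open>A\<close>.\<close>

lemma piece_sequences:
  fixes A :: "real set"
  assumes A: "A \<subseteq> {0<..}" "0 islimpt A" and r: "r > 0" "r \<in> closure A"
  shows "\<exists>\<epsilon> \<rho>. range \<epsilon> \<subseteq> A \<and> range \<rho> \<subseteq> A \<and> (\<forall>n. \<epsilon> (Suc n) \<le> \<epsilon> n) \<and> \<epsilon> \<longlonglongrightarrow> 0 \<and>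
    \<epsilon> 0 \<le> r / 2 \<and> (\<forall>n. \<bar>\<rho> n - r\<bar> \<le> \<epsilon> n / 2) \<and> (r \<in> A \<longrightarrow> \<rho> 0 = r)"
proof -
  have small: "\<exists>a\<in>A. a \<le> e" if e: "e > 0" for e
  proof -
    obtain a where "a \<in> A" "\<bar>a - 0\<bar> < e"
      using A(2) e unfolding islimpt_approachable dist_real_def by blast
    then show ?thesis by (intro bexI[of _ a]) auto
  qed
  have "\<exists>\<epsilon>. \<forall>n. (\<epsilon> n \<in> A \<and> \<epsilon> n \<le> r / 2 \<and> \<epsilon> n \<le> inverse (real (Suc n))) \<and> \<epsilon> (Suc n) \<le> \<epsilon> n"
  proof (rule dependent_nat_choice)
    show "\<exists>x. x \<in> A \<and> x \<le> r / 2 \<and> x \<le> inverse (real (Suc 0))"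
      using small[of "min (r / 2) 1"] r by auto
    fix x and n :: nat assume "x \<in> A \<and> x \<le> r / 2 \<and> x \<le> inverse (real (Suc n))"
    then show "\<exists>y. (y \<in> A \<and> y \<le> r / 2 \<and> y \<le> inverse (real (Suc (Suc n)))) \<and> y \<le> x"
      using small[of "min x (inverse (real (Suc (Suc n))))"] A(1) by fastforce
  qed
  then obtain \<epsilon> where \<epsilon>: "\<And>n. \<epsilon> n \<in> A" "\<And>n. \<epsilon> n \<le> r / 2"
    "\<And>n. \<epsilon> n \<le> inverse (real (Suc n))" "\<And>n. \<epsilon> (Suc n) \<le> \<epsilon> n" by blast
  have pos: "\<epsilon> n > 0" for n using \<epsilon>(1) A(1) by auto
  have lim: "\<epsilon> \<longlonglongrightarrow> 0"
    using pos \<epsilon>(3)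
    by (auto intro!: tendsto_sandwich[OF _ _ tendsto_const LIMSEQ_inverse_real_of_nat]
        always_eventually simp: less_imp_le)
  have "\<exists>a\<in>A. \<bar>a - r\<bar> \<le> \<epsilon> n / 2 \<and> (r \<in> A \<longrightarrow> a = r)" for n
  proof (cases "r \<in> A")
    case True
    then show ?thesis using pos[of n] by (intro bexI[of _ r]) auto
  next
    case False
    then show ?thesis
      using r(2) pos[of n] unfolding closure_approachable dist_real_def
      by (metis half_gt_zero less_imp_le)
  qed
  then obtain \<rho> where "\<And>n. \<rho> n \<in> A" "\<And>n. \<bar>\<rho> n - r\<bar> \<le> \<epsilon> n / 2" "\<And>n. r \<in> A \<longrightarrow> \<rho> n = r"
    by metis
  then show ?thesis using \<epsilon> lim by blast
qed

text \<open>The scheme need not be monotone, so all prefixes are tested. The root is always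
  included, which keeps the associated closed set nonempty and the distance between the two roots
  available.\<close>

definition scheme_tree :: "(nat list \<Rightarrow> 'x set) \<Rightarrow> 'x \<Rightarrow> nat list set" where
  "scheme_tree Q x = {u. u = [] \<or> (\<forall>n\<le>length u. x \<in> Q (take n u))}"

lemma scheme_tree_take: "u \<in> scheme_tree Q x \<Longrightarrow> take n u \<in> scheme_tree Q x"
  by (auto simp: scheme_tree_def min_def)

lemma illfounded_scheme_tree:
  "illfounded (scheme_tree Q x) \<longleftrightarrow> (\<exists>w. \<forall>n. x \<in> Q (map w [0..<n]))"
proof -
  have "(\<forall>n. map w [0..<n] \<in> scheme_tree Q x) \<longleftrightarrow> (\<forall>n. x \<in> Q (map w [0..<n]))" for w
  proof (intro iffI allI)
    fix n assume "\<forall>n. map w [0..<n] \<in> scheme_tree Q x"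
    \<comment> \<open>The root lies in the tree without any test; passing to length
      \<open>Suc n\<close> yields membership in \<open>Q\<close> also for
      \<open>n = 0\<close>.\<close>
    then have "map w [0..<Suc n] \<in> scheme_tree Q x" by blast
    then have "x \<in> Q (take n (map w [0..<Suc n]))"
      unfolding scheme_tree_def by (auto simp del: upt_Suc take_map)
    then show "x \<in> Q (map w [0..<n])" by (simp add: take_map min_def)
  next
    fix n assume "\<forall>n. x \<in> Q (map w [0..<n])"
    then show "map w [0..<n] \<in> scheme_tree Q x"
      by (auto simp: scheme_tree_def take_map min_def)
  qed
  then show ?thesis unfolding illfounded_def by simp
qed

lemma sets_scheme_tree:
  assumes "\<And>u. Q u \<in> sets X"
  shows "{x \<in> space X. u \<in> scheme_tree Q x} \<in> sets X"
  using assms unfolding scheme_tree_def by measurable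

text \<open>The pieces with index \<open>i \<ge> 2\<close> have a trivial tree and only serve to realise all distances in
  \<open>A - {r, s}\<close>.\<close>

lemma distance_reduction:
  fixes X :: "'x measure" and A :: "real set"
  assumes U: "urysohn_space M d" and A: "countable A" "A \<subseteq> {0..}" "0 \<in> A" "0 islimpt A"
    and r: "r islimpt A" "r > 0" and s: "s islimpt A" "s > 0"
    and B: "B \<in> analytic_sets X" "B' \<in> analytic_sets X"
  obtains F where "F \<in> X \<rightarrow>\<^sub>M effros_borel (Metric_space.mtopology M d)"
    "\<And>x. x \<in> space X \<Longrightarrow> F x \<in> closed_sets (Metric_space.mtopology M d)"
    "\<And>x. x \<in> space X \<Longrightarrow>
      distance_set d (F x) = A - {r, s} \<union> {v. v = r \<and> x \<in> B \<or> v = s \<and> x \<in> B'}"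
proof -
  \<comment> \<open>All distances between nodes will be 0 or in \<open>P\<close>, so
    \<open>r\<close> and \<open>s\<close> can appear only through branches. Removing finitely many
    points preserves the limit points.\<close>
  define P where "P = A - {0, r, s}"
  have P: "countable P" "P \<subseteq> {0<..}" "A - {r, s} = insert 0 P"
  proof -
    show "countable P" using A(1) by (simp add: P_def)
    show "P \<subseteq> {0<..}" using A(2) by (auto simp: P_def subset_iff less_le)
    show "A - {r, s} = insert 0 P" using A(3) r(2) s(2) unfolding P_def by blast
  qed
  have limP: "a islimpt P" if "a islimpt A" for a
  proof -
    have "a islimpt {0, r, s} \<union> P"
      by (rule islimpt_subset[OF that]) (auto simp: P_def)
    then show ?thesis using islimpt_Un_finite[of "{0, r, s}" a P] by simp
  qed
  have "P \<noteq> {}" using limP[OF A(4)] by auto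
  then have range_a: "range (from_nat_into P) = P" using P(1) by (rule range_from_nat_into)
  \<comment> \<open>Indices 0 and 1 carry the controlled values, which lie in the closure of
    \<open>P\<close> but not in \<open>P\<close>; the other indices enumerate
    \<open>P\<close>.\<close>
  define R where "R i = (if i = 0 then r else if i = 1 then s else from_nat_into P (i - 2))" for i :: nat
  have R_P: "R i \<in> P" if "i \<ge> 2" for i
    using that from_nat_into[OF \<open>P \<noteq> {}\<close>] by (auto simp: R_def)
  have R: "R i > 0" "R i \<in> closure P" for i
  proof -
    have "i = 0 \<or> i = 1 \<or> i \<ge> 2" by auto
    then consider "R i = r" | "R i = s" | "i \<ge> 2" by (auto simp: R_def)
    then have "R i > 0 \<and> R i \<in> closure P"
    proof cases
      case 3
      then show ?thesis using R_P P(2) closure_subset by fastforce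
    qed (use r s limP in \<open>auto simp: closure_def\<close>)
    then show "R i > 0" "R i \<in> closure P" by auto
  qed
  have P_R: "\<exists>i. a = R i" if "a \<in> P" for a
  proof -
    have "a \<in> range (from_nat_into P)" using that range_a by simp
    then obtain n where "a = from_nat_into P n" by auto
    then have "a = R (n + 2)" by (simp add: R_def)
    then show ?thesis by blast
  qed
  define fits where "fits i \<epsilon> \<rho> \<longleftrightarrow> range \<epsilon> \<subseteq> P \<and> range \<rho> \<subseteq> P \<and>
    (\<forall>n. \<epsilon> (Suc n) \<le> \<epsilon> n) \<and> \<epsilon> \<longlonglongrightarrow> 0 \<and> \<epsilon> 0 \<le> R i / 2 \<and>
    (\<forall>n. \<bar>\<rho> n - R i\<bar> \<le> \<epsilon> n / 2) \<and> (R i \<in> P \<longrightarrow> \<rho> 0 = R i)"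
    for i :: nat and \<epsilon> \<rho> :: "nat \<Rightarrow> real"
  have "\<exists>\<epsilon> \<rho>. fits i \<epsilon> \<rho>" for i
    unfolding fits_def by (rule piece_sequences[OF P(2) limP[OF A(4)] R])
  then obtain \<epsilon> \<rho> where fits: "\<And>i. fits i (\<epsilon> i) (\<rho> i)" by metis
  have \<epsilon>: "\<And>i n. \<epsilon> i n \<in> P" "\<And>i n. \<rho> i n \<in> P" "\<And>i n. \<epsilon> i (Suc n) \<le> \<epsilon> i n"
    "\<And>i. \<epsilon> i \<longlonglongrightarrow> 0" "\<And>i. \<epsilon> i 0 \<le> R i / 2" "\<And>i n. \<bar>\<rho> i n - R i\<bar> \<le> \<epsilon> i n / 2"
    "\<And>i. R i \<in> P \<Longrightarrow> \<rho> i 0 = R i"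
    using fits unfolding fits_def by (simp_all add: image_subset_iff)
  interpret Metric_space M d using U by (simp add: urysohn_space_def polish_metric_def)
  have \<epsilon>_pos: "\<epsilon> i n > 0" for i n using \<epsilon>(1) P(2) by auto
  \<comment> \<open>The separation constant is itself an element of \<open>P\<close>, so every
    \<open>cross i j\<close>, a maximum of elements of \<open>P\<close>, lies in
    \<open>P\<close>.\<close>
  interpret T: tree_pieces "R 2" \<epsilon> \<rho> R
    by unfold_locales (rule R(1) \<epsilon>_pos \<epsilon>)+
  have inf: "infinite (UNIV :: point set)"
    by (simp add: finite_prod)
  obtain f where f: "\<And>x. f x \<in> M" "\<And>x y. d (f x) (f y) = T.\<delta> x y"
    using urysohn_embeds_countable[OF U T.Metric_space_delta inf] by blast
  interpret E: embedded_tree_pieces "R 2" \<epsilon> \<rho> R M d f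
    using f U by unfold_locales (auto simp: urysohn_space_def polish_metric_def)
  obtain Q :: "nat list \<Rightarrow> 'x set" where Q: "\<And>u. Q u \<in> sets X"
    "\<And>x. x \<in> space X \<Longrightarrow> x \<in> B \<longleftrightarrow> (\<exists>w. \<forall>n. x \<in> Q (map w [0..<n]))"
    using analytic_sets_scheme[OF B(1)] by blast
  obtain Q' :: "nat list \<Rightarrow> 'x set" where Q': "\<And>u. Q' u \<in> sets X"
    "\<And>x. x \<in> space X \<Longrightarrow> x \<in> B' \<longleftrightarrow> (\<exists>w. \<forall>n. x \<in> Q' (map w [0..<n]))"
    using analytic_sets_scheme[OF B(2)] by blast
  define W where "W i = (if i = 0 then Q else if i = 1 then Q' else (\<lambda>_. {}))" for i :: nat
  have W: "W i u \<in> sets X" for i u using Q Q' by (simp add: W_def)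
  define T where "T x i = scheme_tree (W i) x" for x i
  define F where "F x = E.tree_space (T x)" for x
  have nil: "[] \<in> T x i" for x i by (simp add: T_def scheme_tree_def)
  have closed: "F x \<in> closed_sets mtopology" for x
    unfolding F_def by (rule E.tree_space_closed) (rule nil)
  have "F \<in> X \<rightarrow>\<^sub>M effros_borel mtopology"
  proof (rule measurable_effros_borelI)
    fix U assume U: "openin mtopology U"
    have [measurable]: "Measurable.pred X (\<lambda>x. u \<in> T x i)" for u i
      using sets_scheme_tree[OF W] by (simp add: pred_def T_def)
    have "{x \<in> space X. \<exists>i b u. u \<in> T x i \<and> f (i, b, u) \<in> U} \<in> sets X"
      by measurable
    then show "{x \<in> space X. F x \<inter> U \<noteq> {}} \<in> sets X"
      unfolding F_def E.tree_space_hit[OF U] .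
  qed (rule closed)
  moreover have "distance_set d (F x) = A - {r, s} \<union> {v. v = r \<and> x \<in> B \<or> v = s \<and> x \<in> B'}"
    if x: "x \<in> space X" for x
  proof -
    have ill: "illfounded (T x 0) \<longleftrightarrow> x \<in> B" "illfounded (T x 1) \<longleftrightarrow> x \<in> B'"
      using Q(2)[OF x] Q'(2)[OF x] by (simp_all add: T_def illfounded_scheme_tree W_def)
    have val: "T.\<delta> p p' \<in> insert 0 P" for p p'
      using \<epsilon>(1,2) R_P[of 2]
      by (cases p, cases p') (auto simp: T.\<delta>.simps T.cross_def max_def)
    show ?thesis
    proof (intro equalityI subsetI)
      fix v assume v: "v \<in> distance_set d (F x)"
      show "v \<in> A - {r, s} \<union> {v. v = r \<and> x \<in> B \<or> v = s \<and> x \<in> B'}"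
      proof (cases "v \<in> insert 0 P")
        case False
        then have "v \<noteq> T.\<delta> p p'" for p p' using val by metis
        then obtain i where i: "v = R i" "illfounded (T x i)"
          using E.distance_cases[of v "T x"] v scheme_tree_take unfolding F_def T_def by metis
        \<comment> \<open>For the remaining pieces \<open>R i\<close> is in \<open>P\<close>,
          whereas \<open>v\<close> is not.\<close>
        then have "i < 2" using R_P[of i] False by (meson insertI2 not_less)
        then have "i = 0 \<or> i = 1" by auto
        then show ?thesis using i ill by (auto simp: R_def)
      qed (auto simp: P(3))
    next
      fix v assume "v \<in> A - {r, s} \<union> {v. v = r \<and> x \<in> B \<or> v = s \<and> x \<in> B'}"
      then consider "v = 0" | "v \<in> P" | "v = R 0" "x \<in> B" | "v = R 1" "x \<in> B'"
        unfolding P(3) by (auto simp: R_def)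
      then show "v \<in> distance_set d (F x)"
      proof cases
        case 1
        then show ?thesis
          using E.distance_delta[of "[]" "T x" 0 "[]" 0 True True] nil by (simp add: F_def T.delta_self)
      next
        case 2
        then obtain i where i: "v = R i" using P_R by blast
        then have "\<rho> i 0 = v" using \<epsilon>(7) 2 by simp
        then show ?thesis
          using E.distance_delta[of "[]" "T x" i "[]" i True False] nil by (simp add: F_def T.delta_rho)
      next
        case 3
        then show ?thesis using E.distance_illfounded ill by (simp add: F_def)
      next
        case 4
        then show ?thesis using E.distance_illfounded ill by (simp add: F_def)
      qed
    qed
  qed
  ultimately show ?thesis using closed that by blast
qed

theorem theorem4p9:
  fixes M :: "'u set" and d :: "'u \<Rightarrow> 'u \<Rightarrow> real" and A :: "real set"
  assumes "urysohn_space M d"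
    and "countable A" and "A \<subseteq> {0..}" and "0 \<in> A"
  shows
    "(\<not> 0 islimpt A \<or> (\<forall>a. a islimpt A \<longleftrightarrow> a = 0) \<longrightarrow>
        V_star M d A \<in> sets (effros_borel (Metric_space.mtopology M d))) \<and>
     (0 islimpt A \<and> closed A \<and> (\<exists>a. a islimpt A \<and> a \<noteq> 0) \<longrightarrow>
        pointclass_complete TYPE('x) Sigma11
          (effros_borel (Metric_space.mtopology M d)) (V_star M d A)) \<and>
     (0 islimpt A \<and> \<not> closed A \<and> (\<forall>a. a islimpt A \<and> a \<noteq> 0 \<longrightarrow> a \<notin> A) \<longrightarrow>
        pointclass_complete TYPE('x) Pi11
          (effros_borel (Metric_space.mtopology M d)) (V_star M d A)) \<and>
     (0 islimpt A \<and> \<not> closed A \<and> (\<exists>a\<in>A. a islimpt A \<and> a \<noteq> 0) \<longrightarrow>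
        pointclass_complete TYPE('x) D2_Sigma11
          (effros_borel (Metric_space.mtopology M d)) (V_star M d A))"
proof -
  have polish: "polish_metric M d" using assms(1) by (simp add: urysohn_space_def)
  interpret Metric_space M d using polish by (simp add: polish_metric_def)
  have complete: mcomplete using polish by (simp add: polish_metric_def)
  \<comment> \<open>Embedding a one-point space shows that \<open>M\<close> is nonempty, so a dense
    sequence exists.\<close>
  have "polish_metric {0 :: real} (\<lambda>x y. 0)"
    by (rule finite_polish_metric) (unfold_locales, auto)
  then obtain f where "isometric_embedding {0 :: real} (\<lambda>x y. 0) M d f"
    using assms(1) unfolding urysohn_space_def by blast
  then have "M \<noteq> {}" unfolding isometric_embedding_def by auto
  then obtain q where "metric_with_dense_sequence M d q"
    using polish polish_metric_dense_sequence by blast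
  then interpret metric_with_dense_sequence M d q .
  have ne: "A \<noteq> {}" using assms(4) by blast
  have pos: "a > 0" if "a islimpt A" "a \<noteq> 0" for a
  proof -
    have "a islimpt {0..}" using islimpt_subset[OF that(1) assms(3)] .
    then have "a \<in> {0..}" using closed_limpt[of "{0 :: real..}"] by blast
    then show ?thesis using that(2) by simp
  qed
  have vimage: "F -` V_star M d A \<inter> space X = {x \<in> space X. distance_set d (F x) = A}"
    if "\<And>x. x \<in> space X \<Longrightarrow> F x \<in> CL" for F and X :: "'x measure"
    using that by (auto simp: V_star_def)
  show ?thesis
  proof (intro conjI impI)
    assume "\<not> 0 islimpt A \<or> (\<forall>a. a islimpt A \<longleftrightarrow> a = 0)"
    then show "V_star M d A \<in> sets EB"
    proof
      assume "\<not> 0 islimpt A"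
      then show ?thesis by (rule V_star_borel_discrete[OF assms(2,3)])
    next
      assume *: "\<forall>a. a islimpt A \<longleftrightarrow> a = 0"
      then have "closed A" using assms(4) by (simp add: closed_limpt)
      then show ?thesis using * by (intro V_star_borel_closed assms) auto
    qed
  next
    assume *: "0 islimpt A \<and> closed A \<and> (\<exists>a. a islimpt A \<and> a \<noteq> 0)"
    then obtain r where r: "r islimpt A" "r \<noteq> 0" by blast
    have "r \<in> A" using * r(1) by (auto simp: closed_limpt)
    have "\<exists>F. F \<in> X \<rightarrow>\<^sub>M EB \<and> F -` V_star M d A \<inter> space X = B"
      if B: "B \<in> analytic_sets X" for X :: "'x measure" and B
    proof -
      \<comment> \<open>One limit point in \<open>A\<close> suffices, so both controlled values are
        taken to be \<open>r\<close>; it is realised exactly on \<open>B\<close>.\<close>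
      obtain F where F: "F \<in> X \<rightarrow>\<^sub>M EB" "\<And>x. x \<in> space X \<Longrightarrow> F x \<in> CL"
        "\<And>x. x \<in> space X \<Longrightarrow>
          distance_set d (F x) = A - {r, r} \<union> {v. v = r \<and> x \<in> B \<or> v = r \<and> x \<in> B}"
        using distance_reduction[OF assms * [THEN conjunct1] r(1) pos[OF r] r(1) pos[OF r] B B]
        by blast
      have "(A - {r, r} \<union> {v. v = r \<and> x \<in> B \<or> v = r \<and> x \<in> B} = A) \<longleftrightarrow> x \<in> B" for x
        using \<open>r \<in> A\<close> by auto
      then have "{x \<in> space X. distance_set d (F x) = A} = B"
        using F(3) analytic_sets_subset[OF B] by auto
      moreover have "F -` V_star M d A \<inter> space X = {x \<in> space X. distance_set d (F x) = A}"
        by (rule vimage) (rule F(2))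
      ultimately have "F -` V_star M d A \<inter> space X = B" by simp
      then show ?thesis using F(1) by blast
    qed
    then show "pointclass_complete TYPE('x) Sigma11 EB (V_star M d A)"
      using V_star_analytic[OF complete assms(2) ne] * by (simp add: pointclass_complete_def)
  next
    assume *: "0 islimpt A \<and> \<not> closed A \<and> (\<forall>a. a islimpt A \<and> a \<noteq> 0 \<longrightarrow> a \<notin> A)"
    \<comment> \<open>A set that is not closed omits one of its limit points. Realising this
      forbidden value exactly off \<open>B\<close> reduces the coanalytic set
      \<open>B\<close>.\<close>
    then obtain r where r: "r islimpt A" "r \<notin> A" by (auto simp: closed_limpt)
    have "r \<noteq> 0" using r(2) assms(4) by blast
    have "\<exists>F. F \<in> X \<rightarrow>\<^sub>M EB \<and> F -` V_star M d A \<inter> space X = B"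
      if B: "B \<in> coanalytic_sets X" for X :: "'x measure" and B
    proof -
      have an: "space X - B \<in> analytic_sets X" "B \<subseteq> space X"
        using B by (auto simp: coanalytic_sets_def)
      obtain F where F: "F \<in> X \<rightarrow>\<^sub>M EB" "\<And>x. x \<in> space X \<Longrightarrow> F x \<in> CL"
        "\<And>x. x \<in> space X \<Longrightarrow> distance_set d (F x) =
          A - {r, r} \<union> {v. v = r \<and> x \<in> space X - B \<or> v = r \<and> x \<in> space X - B}"
        using distance_reduction[OF assms * [THEN conjunct1] r(1) pos[OF r(1) \<open>r \<noteq> 0\<close>]
            r(1) pos[OF r(1) \<open>r \<noteq> 0\<close>] an(1) an(1)]
        by blast
      have "(A - {r, r} \<union> {v. v = r \<and> x \<in> space X - B \<or> v = r \<and> x \<in> space X - B} = A) \<longleftrightarrow> x \<in> B"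
        if "x \<in> space X" for x
        using r(2) that by auto
      then have "{x \<in> space X. distance_set d (F x) = A} = B"
        using F(3) an(2) by auto
      moreover have "F -` V_star M d A \<inter> space X = {x \<in> space X. distance_set d (F x) = A}"
        by (rule vimage) (rule F(2))
      ultimately have "F -` V_star M d A \<inter> space X = B" by simp
      then show ?thesis using F(1) by blast
    qed
    then show "pointclass_complete TYPE('x) Pi11 EB (V_star M d A)"
      using V_star_coanalytic[OF complete assms(2,4)] * by (simp add: pointclass_complete_def) blast
  next
    assume *: "0 islimpt A \<and> \<not> closed A \<and> (\<exists>a\<in>A. a islimpt A \<and> a \<noteq> 0)"
    then obtain s where s: "s islimpt A" "s \<notin> A" by (auto simp: closed_limpt)
    obtain r where r: "r islimpt A" "r \<noteq> 0" "r \<in> A" using * by blast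
    have "s \<noteq> 0" using s(2) assms(4) by blast
    have "\<exists>F. F \<in> X \<rightarrow>\<^sub>M EB \<and> F -` V_star M d A \<inter> space X = P \<inter> Q"
      if P: "P \<in> analytic_sets X" and Q: "Q \<in> coanalytic_sets X" for X :: "'x measure" and P Q
    proof -
      have an: "space X - Q \<in> analytic_sets X" "Q \<subseteq> space X"
        using Q by (auto simp: coanalytic_sets_def)
      \<comment> \<open>The required value \<open>r\<close> is realised exactly on \<open>P\<close>
        and the forbidden value \<open>s\<close> exactly off \<open>Q\<close>, so the distance set
        is \<open>A\<close> precisely on \<open>P \<inter> Q\<close>.\<close>
      obtain F where F: "F \<in> X \<rightarrow>\<^sub>M EB" "\<And>x. x \<in> space X \<Longrightarrow> F x \<in> CL"
        "\<And>x. x \<in> space X \<Longrightarrow> distance_set d (F x) =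
          A - {r, s} \<union> {v. v = r \<and> x \<in> P \<or> v = s \<and> x \<in> space X - Q}"
        using distance_reduction[OF assms * [THEN conjunct1] r(1) pos[OF r(1,2)]
            s(1) pos[OF s(1) \<open>s \<noteq> 0\<close>] P an(1)]
        by blast
      have "(A - {r, s} \<union> {v. v = r \<and> x \<in> P \<or> v = s \<and> x \<in> space X - Q} = A) \<longleftrightarrow> x \<in> P \<inter> Q"
        if "x \<in> space X" for x
      proof
        assume eq: "A - {r, s} \<union> {v. v = r \<and> x \<in> P \<or> v = s \<and> x \<in> space X - Q} = A"
        show "x \<in> P \<inter> Q"
          using that r(3) s(2) eq[THEN eqset_imp_iff, of r] eq[THEN eqset_imp_iff, of s] by auto
      next
        assume "x \<in> P \<inter> Q"
        then show "A - {r, s} \<union> {v. v = r \<and> x \<in> P \<or> v = s \<and> x \<in> space X - Q} = A"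
          using r(3) s(2) by auto
      qed
      then have "distance_set d (F x) = A \<longleftrightarrow> x \<in> P \<inter> Q" if "x \<in> space X" for x
        using that F(3)[OF that] by simp
      then have "{x \<in> space X. distance_set d (F x) = A} = P \<inter> Q"
        using an(2) by auto
      moreover have "F -` V_star M d A \<inter> space X = {x \<in> space X. distance_set d (F x) = A}"
        by (rule vimage) (rule F(2))
      ultimately have "F -` V_star M d A \<inter> space X = P \<inter> Q" by simp
      then show ?thesis using F(1) by blast
    qed
    then show "pointclass_complete TYPE('x) D2_Sigma11 EB (V_star M d A)"
      using V_star_D2[OF complete assms(2) ne] by (auto simp: pointclass_complete_def)
  qed
qed

end
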